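(* Let $1<p<+\infty$, $\omega\in\mathbb R$, $\alpha\in\mathbb R$ with $\alpha\ne0$, and $Y\in\mathbb E_2$ with $Y\neq0$. There does not exist a set $\mathcal X$, compact in $L^p(\mathbb S^2)$, with $\varnothing\neq\mathcal X\subsetneqq\mathcal H^+_{\alpha\sin\theta+Y}$, having the following property: for any $\varepsilon>0$ there exists $\delta>0$ such that for any smooth solution $\zeta$ of the vorticity equation $(V_\omega)$, $$\min_{f\in \mathcal X}\|f-\zeta_0\|_{L^p(\mathbb S^2)}<\delta\quad\Longrightarrow\quad \min_{f\in \mathcal X}\|f-\zeta_t\|_{L^p(\mathbb S^2)}<\varepsilon\quad\forall\,t>0.$$
   Context: $\mathbb S^2$ is the unit sphere in $\mathbb R^3$ with the standard metric and area measure $\sigma$, with spherical coordinates $(\varphi,\theta)\mapsto(\cos\theta\cos\varphi,\cos\theta\sin\varphi,\sin\theta)$; thus $\sin\theta=x_3$. All functions are real-valued. $\mathring L^p(\mathbb S^2)$ is the space of $L^p$ functions with zero mean. For $1<r<\infty$ and $f\in\mathring L^r(\mathbb S^2)$, $\mathcal Gf$ is the unique zero-mean function in $W^{2,r}(\mathbb S^2)$ with $-\Delta(\mathcal Gf)=f$ ($\Delta$ the Laplace-Beltrami operator). $J$ is the anticlockwise rotation by $\pi/2$ in the tangent planes, i.e. $J\mathbf v=\mathbf x\times\mathbf v$ at $\mathbf x\in\mathbb S^2$; in coordinates $J\nabla f=-\partial_\theta f\,\mathbf e_\varphi+\frac1{\cos\theta}\partial_\varphi f\,\mathbf e_\theta$.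 For a fixed rotation speed $\omega\in\mathbb R$, the vorticity equation $(V_\omega)$ for the absolute vorticity $\zeta$ is $$\partial_t\zeta+J\nabla(\omega\sin\theta-\mathcal G\zeta)\cdot\nabla\zeta=0\quad\text{on }\mathbb S^2,\ t>0.$$ A smooth solution is a smooth function $\zeta$ on $\mathbb S^2\times[0,\infty)$, of zero mean on $\mathbb S^2$ at each time, satisfying this equation; $\zeta_t:=\zeta(\cdot,t)$. $\mathbb E_2$ is the space of real functions $Y$ on $\mathbb S^2$ with $-\Delta Y=6Y$. For $f:\mathbb S^2\to\mathbb R$, $\mathcal H^+_f=\{f\circ\mathsf g\mid\mathsf g\in\mathbf H^+\}$, where $\mathbf H^+$ is the group of rotations about the $x_3$-axis; in coordinates $\mathcal H^+_f=\{f(\varphi+\beta,\theta)\mid\beta\in\mathbb R\}$. *)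

theory Defs
  imports "HOL-Analysis.Analysis"
begin

text \<open>
  A function on the unit sphere is represented by a function on \<open>real ^ 3\<close> of which only the values
  on \<open>S2\<close> matter; every notion below ignores the values elsewhere.
\<close>

abbreviation S2 :: "(real ^ 3) set" where
  "S2 \<equiv> sphere 0 1"

subsection \<open>Area measure, Lebesgue spaces\<close>

definition sph_coord :: "real \<times> real \<Rightarrow> real ^ 3" where
  "sph_coord = (\<lambda>(\<phi>, \<theta>). vector [cos \<theta> * cos \<phi>, cos \<theta> * sin \<phi>, sin \<theta>])"

text \<open>
  The area element in spherical coordinates is \<open>cos \<theta> d\<phi> d\<theta>\<close>. The underlying space of \<open>\<sigma>\<close> is
  \<open>S2\<close> rather than \<open>real ^ 3\<close>, so that measurability and integrals do not see values off the sphere.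
\<close>

definition \<sigma> :: "(real ^ 3) measure" where
  "\<sigma> = distr
     (density lborel
       (\<lambda>(\<phi>, \<theta>). ennreal (indicator ({0..2 * pi} \<times> {- pi / 2..pi / 2}) (\<phi>, \<theta>) * cos \<theta>)))
     (restrict_space borel S2) sph_coord"

definition Lp :: "real \<Rightarrow> (real ^ 3 \<Rightarrow> real) set" where
  "Lp p = {f \<in> borel_measurable \<sigma>. integrable \<sigma> (\<lambda>x. \<bar>f x\<bar> powr p)}"

definition Lp_norm :: "real \<Rightarrow> (real ^ 3 \<Rightarrow> real) \<Rightarrow> real" where
  "Lp_norm p f = (\<integral>x. \<bar>f x\<bar> powr p \<partial>\<sigma>) powr (1 / p)"

text \<open>
  Functions are not identified modulo null sets, so this is the topology of a seminorm. A set of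
  functions is compact for it iff the set of their equivalence classes is compact in the normed space.
\<close>

definition Lp_topology :: "real \<Rightarrow> (real ^ 3 \<Rightarrow> real) topology" where
  "Lp_topology p =
     topology_generated_by {{g \<in> Lp p. Lp_norm p (\<lambda>x. f x - g x) < e} | f e. f \<in> Lp p \<and> e > 0}"

definition zero_mean :: "(real ^ 3 \<Rightarrow> real) \<Rightarrow> bool" where
  "zero_mean f \<longleftrightarrow> integrable \<sigma> f \<and> (\<integral>x. f x \<partial>\<sigma>) = 0"

subsection \<open>Smooth functions\<close>

primrec Ck_on :: "nat \<Rightarrow> ('a::real_normed_vector \<Rightarrow> real) \<Rightarrow> 'a set \<Rightarrow> bool" where
  "Ck_on 0 f U \<longleftrightarrow> continuous_on U f"
| "Ck_on (Suc k) f U \<longleftrightarrow>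
     (\<forall>x\<in>U. f differentiable (at x)) \<and> (\<forall>v. Ck_on k (\<lambda>x. frechet_derivative f (at x) v) U)"

text \<open>
  Smoothness on a subset of Euclidean space, in the sense of having a smooth extension to an open
  neighbourhood. It is used for \<open>S2\<close> and for \<open>S2 \<times> {0..}\<close>, where it means smoothness up to time 0.
\<close>

definition smooth_on :: "('a::euclidean_space \<Rightarrow> real) \<Rightarrow> 'a set \<Rightarrow> bool" where
  "smooth_on f A \<longleftrightarrow>
     (\<exists>U F. open U \<and> A \<subseteq> U \<and> (\<forall>k. Ck_on k F U) \<and> (\<forall>x\<in>A. F x = f x))"

subsection \<open>Differential operators on the sphere\<close>

text \<open>
  As \<open>sgn y = y /\<^sub>R norm y\<close> is a retraction onto the sphere whose derivative at \<open>x \<in> S2\<close> is the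
  orthogonal projection onto the tangent plane, \<open>sph_diff f x v\<close> is the differential at \<open>x\<close> of
  the function \<open>f\<close> on the sphere, applied to the tangential part of \<open>v\<close>.
\<close>

definition sph_diff :: "(real ^ 3 \<Rightarrow> 'b::real_normed_vector) \<Rightarrow> real ^ 3 \<Rightarrow> real ^ 3 \<Rightarrow> 'b" where
  "sph_diff f x v = frechet_derivative (\<lambda>y. f (sgn y)) (at x) v"

definition grad :: "(real ^ 3 \<Rightarrow> real) \<Rightarrow> real ^ 3 \<Rightarrow> real ^ 3" where
  "grad f x = (\<Sum>e\<in>Basis. sph_diff f x e *\<^sub>R e)"

text \<open>
  The Levi-Civita connection of an embedded surface is the tangential part of the derivative of a
  tangent field. The trace and the norm below may be computed with a basis of \<open>real ^ 3\<close>
  because the normal direction contributes zero.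
\<close>

definition cov_deriv :: "(real ^ 3 \<Rightarrow> real ^ 3) \<Rightarrow> real ^ 3 \<Rightarrow> real ^ 3 \<Rightarrow> real ^ 3" where
  "cov_deriv V x v = sph_diff V x v - (x \<bullet> sph_diff V x v) *\<^sub>R x"

definition sph_div :: "(real ^ 3 \<Rightarrow> real ^ 3) \<Rightarrow> real ^ 3 \<Rightarrow> real" where
  "sph_div V x = (\<Sum>e\<in>Basis. cov_deriv V x e \<bullet> e)"

definition laplace_beltrami :: "(real ^ 3 \<Rightarrow> real) \<Rightarrow> real ^ 3 \<Rightarrow> real" where
  "laplace_beltrami f = sph_div (grad f)"

definition hess_norm :: "(real ^ 3 \<Rightarrow> real) \<Rightarrow> real ^ 3 \<Rightarrow> real" where
  "hess_norm f x = sqrt (\<Sum>e\<in>Basis. (norm (cov_deriv (grad f) x e))\<^sup>2)"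

definition J :: "real ^ 3 \<Rightarrow> real ^ 3 \<Rightarrow> real ^ 3" where
  "J x v = cross3 x v"

subsection \<open>The inverse of the negative Laplacian\<close>

definition W2_norm :: "real \<Rightarrow> (real ^ 3 \<Rightarrow> real) \<Rightarrow> real" where
  "W2_norm r f =
     (\<integral>x. \<bar>f x\<bar> powr r + norm (grad f x) powr r + hess_norm f x powr r \<partial>\<sigma>) powr (1 / r)"

text \<open>
  The Sobolev space \<open>W\<^sup>2\<^sup>,\<^sup>r\<close> is the completion, inside the Lebesgue space, of the smooth functions
  for \<open>W2_norm r\<close>; \<open>W2_approx r u g\<close> says that \<open>g\<close> is the element of it represented by the
  Cauchy sequence \<open>u\<close>.
\<close>

definition W2_approx :: "real \<Rightarrow> (nat \<Rightarrow> real ^ 3 \<Rightarrow> real) \<Rightarrow> (real ^ 3 \<Rightarrow> real) \<Rightarrow> bool" where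
  "W2_approx r u g \<longleftrightarrow>
     g \<in> Lp r \<and> (\<forall>n. smooth_on (u n) S2) \<and>
     (\<forall>e>0. \<exists>N. \<forall>m\<ge>N. \<forall>n\<ge>N. W2_norm r (\<lambda>x. u m x - u n x) < e) \<and>
     (\<lambda>n. Lp_norm r (\<lambda>x. u n x - g x)) \<longlonglongrightarrow> 0"

definition W2 :: "real \<Rightarrow> (real ^ 3 \<Rightarrow> real) set" where
  "W2 r = {g. \<exists>u. W2_approx r u g}"

text \<open>The continuous extension of the Laplace-Beltrami operator to a map from \<open>W2 r\<close> to \<open>Lp r\<close>,
  as a relation (both sides being determined up to null sets).\<close>

definition W2_laplacian :: "real \<Rightarrow> (real ^ 3 \<Rightarrow> real) \<Rightarrow> (real ^ 3 \<Rightarrow> real) \<Rightarrow> bool" where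
  "W2_laplacian r g h \<longleftrightarrow>
     h \<in> Lp r \<and>
     (\<exists>u. W2_approx r u g \<and> (\<lambda>n. Lp_norm r (\<lambda>x. laplace_beltrami (u n) x - h x)) \<longlonglongrightarrow> 0)"

text \<open>
  The graph of the operator \<open>\<G>\<close>: \<open>is_\<G> f g\<close> means \<open>g = \<G> f\<close> almost everywhere. The value does
  not depend on the exponent \<open>r\<close> with \<open>f \<in> Lp r\<close>.
\<close>

definition is_\<G> :: "(real ^ 3 \<Rightarrow> real) \<Rightarrow> (real ^ 3 \<Rightarrow> real) \<Rightarrow> bool" where
  "is_\<G> f g \<longleftrightarrow>
     (\<exists>r>1. f \<in> Lp r \<and> zero_mean f \<and> g \<in> W2 r \<and> zero_mean g \<and> W2_laplacian r g (\<lambda>x. - f x))"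

subsection \<open>The vorticity equation\<close>

text \<open>
  For smooth \<open>\<zeta> t\<close>, elliptic regularity gives \<open>\<G> (\<zeta> t)\<close> exactly one smooth
  representative on the sphere; \<open>\<psi> t\<close> is this representative, whose gradient is then taken pointwise.
\<close>

definition smooth_solution :: "real \<Rightarrow> (real \<Rightarrow> real ^ 3 \<Rightarrow> real) \<Rightarrow> bool" where
  "smooth_solution \<omega> \<zeta> \<longleftrightarrow>
     smooth_on (\<lambda>(x, t). \<zeta> t x) (S2 \<times> {0..}) \<and>
     (\<forall>t\<ge>0. zero_mean (\<zeta> t)) \<and>
     (\<exists>\<psi>. (\<forall>t\<ge>0. smooth_on (\<psi> t) S2 \<and> is_\<G> (\<zeta> t) (\<psi> t)) \<and>
       (\<forall>t>0. \<forall>x\<in>S2.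
          deriv (\<lambda>s. \<zeta> s x) t
            + J x (grad (\<lambda>y. \<omega> * y $ 3 - \<psi> t y) x) \<bullet> grad (\<zeta> t) x = 0))"

subsection \<open>Second eigenspace and rotation orbits\<close>

definition E2 :: "(real ^ 3 \<Rightarrow> real) set" where
  "E2 = {Y. smooth_on Y S2 \<and> (\<forall>x\<in>S2. - laplace_beltrami Y x = 6 * Y x)}"

definition rot3 :: "real \<Rightarrow> real ^ 3 \<Rightarrow> real ^ 3" where
  "rot3 \<beta> x = vector [cos \<beta> * x $ 1 - sin \<beta> * x $ 2, sin \<beta> * x $ 1 + cos \<beta> * x $ 2, x $ 3]"

definition Hplus :: "(real ^ 3 \<Rightarrow> real ^ 3) set" where
  "Hplus = range rot3"

text \<open>The restriction to \<open>S2\<close> makes functions that agree on the sphere equal, so that (proper)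
  inclusion between sets of such functions has its meaning for functions on the sphere.\<close>

definition Hplus_orbit :: "(real ^ 3 \<Rightarrow> real) \<Rightarrow> (real ^ 3 \<Rightarrow> real) set" where
  "Hplus_orbit f = {restrict (f \<circ> g) S2 | g. g \<in> Hplus}"

end

(*
  The waves (\<alpha> + \<eta>) x\<^sub>3 + Y (rotated about the x\<^sub>3-axis by (\<omega> - (\<alpha> + \<eta>) / 3) t) are exact smooth
  solutions. For arbitrarily small \<eta> the angular speed is nonzero, so a solution starting near one
  element of \<X> passes near every element of the orbit. Stability thus makes \<X> dense in the orbit,
  and a compact dense subset is the whole orbit. The waves have zero mean because they
  are Laplacians, whose integral vanishes by Fubini in spherical coordinates.
*)

theory Submission
  imports Defs
begin

subsection \<open>Functions of class C^k\<close>

text \<open>The angular speed comes from the eigenvalues: \<open>\<G>\<close> divides the height by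
  2 and \<open>Y\<close> by 6, and a gradient is orthogonal to its own rotation by J, so that
  \<open>Y\<close> feels the zonal coefficient a only through a/2 - a/6 = a/3, against \<omega>. The
  perturbation is taken along the height because this changes the speed and leaves the
  \<open>Y\<close> part intact. Where the speed is 0 the wave stands still, so \<eta> has to avoid
  one value. Wave and orbit element of equal phase are at the same distance at all times, so a long
  drift costs nothing.

  Most of the length is calculus on the sphere. A function f is replaced by its extension constant
  along rays, sending y to \<open>f (sgn y)\<close>; its first and second derivatives in the radial
  direction vanish, so Euclidean derivatives at points of the sphere yield gradient and Laplacian.

  Orbit elements are functions, while the topology comes from a seminorm. That orbit elements at
  distance 0 coincide has to be proved for proper inclusion to contradict density.\<close>

lemma frechet_derivative_cong_open:
  assumes "open U" "x \<in> U" "\<And>y. y \<in> U \<Longrightarrow> f y = g y"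
  shows "frechet_derivative f (at x) = frechet_derivative g (at x)"
proof -
  \<comment> \<open>Equality of the predicates, not of two given derivatives: the choice behind
    \<open>frechet_derivative\<close> then agrees also where no derivative exists.\<close>
  have "(f has_derivative D) (at x) \<longleftrightarrow> (g has_derivative D) (at x)" for D
    using assms has_derivative_transform_within_open[of f D x UNIV U g]
      has_derivative_transform_within_open[of g D x UNIV U f] by auto
  then show ?thesis
    unfolding frechet_derivative_def by simp
qed

lemma differentiable_cong_open:
  assumes "open U" "x \<in> U" "\<And>y. y \<in> U \<Longrightarrow> f y = g y" "f differentiable (at x)"
  shows "g differentiable (at x)"
  using assms has_derivative_transform_within_open[of f _ x UNIV U g]
  unfolding differentiable_def by blast

lemma Ck_on_cong:
  assumes "open U" "\<And>x. x \<in> U \<Longrightarrow> f x = g x" "Ck_on k f U"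
  shows "Ck_on k g U"
  using assms(2,3)
proof (induction k arbitrary: f g)
  case 0
  then show ?case by (simp cong: continuous_on_cong)
next
  case (Suc k)
  have "Ck_on k (\<lambda>x. frechet_derivative g (at x) v) U" for v
    using Suc.IH[of "\<lambda>x. frechet_derivative f (at x) v" "\<lambda>x. frechet_derivative g (at x) v"]
      Suc.prems frechet_derivative_cong_open[OF assms(1), of _ f g] by auto
  then show ?case
    using Suc.prems differentiable_cong_open[OF assms(1), of _ f g] by auto
qed

text \<open>Serves to work with an explicit derivative: the recursion in \<open>Ck_on\<close> speaks
  of \<open>frechet_derivative\<close>, which on the open set \<open>U\<close> equals any known
  formula \<open>f'\<close>.\<close>

lemma Ck_on_SucI:
  assumes "open U" "\<And>x. x \<in> U \<Longrightarrow> (f has_derivative f' x) (at x)"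
    and "\<And>v. Ck_on k (\<lambda>x. f' x v) U"
  shows "Ck_on (Suc k) f U"
proof -
  have "frechet_derivative f (at x) = f' x" if "x \<in> U" for x
    using assms(2)[OF that] frechet_derivative_at by metis
  then have "Ck_on k (\<lambda>x. frechet_derivative f (at x) v) U" for v
    using Ck_on_cong[OF assms(1) _ assms(3)[of v]] by simp
  then show ?thesis
    using assms(2) by (auto simp: differentiable_def)
qed

lemma Ck_on_Suc_has_derivative:
  "Ck_on (Suc k) f U \<Longrightarrow> x \<in> U \<Longrightarrow> (f has_derivative frechet_derivative f (at x)) (at x)"
  by (simp add: frechet_derivative_works)

lemma Ck_on_Suc_continuous: "Ck_on (Suc k) f U \<Longrightarrow> continuous_on U f"
  using Ck_on_Suc_has_derivative has_derivative_continuous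
  by (metis continuous_at_imp_continuous_on)

lemma Ck_on_SucD: "Ck_on (Suc k) f U \<Longrightarrow> Ck_on k f U"
proof (induction k arbitrary: f)
  case 0
  then show ?case using Ck_on_Suc_continuous by (metis Ck_on.simps(1))
next
  case (Suc k)
  then show ?case by (metis Ck_on.simps(2))
qed

lemma Ck_on_const: "open U \<Longrightarrow> Ck_on k (\<lambda>x. c) U"
proof (induction k arbitrary: c)
  case (Suc k)
  show ?case
    by (rule Ck_on_SucI[where f' = "\<lambda>x v. 0"]) (use Suc in auto)
qed simp

lemma Ck_on_linear:
  assumes "open U" "bounded_linear f"
  shows "Ck_on k f U"
proof (cases k)
  case 0
  then show ?thesis using assms by (simp add: linear_continuous_on)
next
  case (Suc k)
  show ?thesis unfolding Suc
    by (rule Ck_on_SucI[where f' = "\<lambda>x. f"])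
      (use assms Ck_on_const in \<open>auto intro: bounded_linear_imp_has_derivative\<close>)
qed

lemma Ck_on_add:
  assumes "open U" "Ck_on k f U" "Ck_on k g U"
  shows "Ck_on k (\<lambda>x. f x + g x) U"
  using assms(2,3)
proof (induction k arbitrary: f g)
  case 0
  then show ?case by (auto intro!: continuous_intros)
next
  case (Suc k)
  show ?case
    by (rule Ck_on_SucI[where f' = "\<lambda>x v. frechet_derivative f (at x) v + frechet_derivative g (at x) v"])
      (use Suc assms(1) Ck_on_Suc_has_derivative in \<open>auto intro!: has_derivative_add simp: frechet_derivative_works\<close>)
qed

lemma Ck_on_sum:
  assumes "open U" "\<And>i. i \<in> I \<Longrightarrow> Ck_on k (f i) U"
  shows "Ck_on k (\<lambda>x. \<Sum>i\<in>I. f i x) U"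
  using assms(2)
  by (induction I rule: infinite_finite_induct) (auto intro: Ck_on_add Ck_on_const assms(1))

text \<open>The product rule pairs derivatives of class \<open>k\<close> with undifferentiated
  factors of class \<open>Suc k\<close>; \<open>Ck_on_SucD\<close> lowers the latter so that the
  induction hypothesis applies.\<close>

lemma Ck_on_mult:
  assumes "open U" "Ck_on k f U" "Ck_on k g U"
  shows "Ck_on k (\<lambda>x. f x * g x) U"
  using assms(2,3)
proof (induction k arbitrary: f g)
  case 0
  then show ?case by (auto intro!: continuous_intros)
next
  case (Suc k)
  show ?case
  proof (rule Ck_on_SucI[where f' = "\<lambda>x v. f x * frechet_derivative g (at x) v + frechet_derivative f (at x) v * g x"])
    show "((\<lambda>x. f x * g x) has_derivative
        (\<lambda>v. f x * frechet_derivative g (at x) v + frechet_derivative f (at x) v * g x)) (at x)"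
      if "x \<in> U" for x
      by (intro has_derivative_mult Ck_on_Suc_has_derivative[OF Suc.prems(1) that]
          Ck_on_Suc_has_derivative[OF Suc.prems(2) that])
    show "Ck_on k (\<lambda>x. f x * frechet_derivative g (at x) v + frechet_derivative f (at x) v * g x) U" for v
      using Suc.prems Suc.prems[THEN Ck_on_SucD] by (intro Ck_on_add Suc.IH assms(1)) simp_all
  qed (rule assms(1))
qed

text \<open>\<open>Ck_on\<close> is for real-valued functions, so regularity of
  \<open>\<phi>\<close> is asked of its components. By the chain rule the derivative is a sum of
  products of component derivatives with partial derivatives of \<open>F\<close> at
  \<open>\<phi> x\<close>; these are new outer functions, so the induction generalises over
  \<open>F\<close>.\<close>

lemma Ck_on_compose:
  fixes \<phi> :: "'a::real_normed_vector \<Rightarrow> 'b::euclidean_space"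
  assumes "open U" "\<And>x. x \<in> U \<Longrightarrow> \<phi> x \<in> V" "\<And>e. e \<in> Basis \<Longrightarrow> Ck_on k (\<lambda>x. \<phi> x \<bullet> e) U"
    and "Ck_on k F V"
  shows "Ck_on k (\<lambda>x. F (\<phi> x)) U"
  using assms(3,4)
proof (induction k arbitrary: F)
  case 0
  then have "continuous_on U \<phi>"
    unfolding continuous_on_componentwise[of U \<phi>] by simp
  then show ?case
    using 0 assms(2) continuous_on_compose2[of V F U \<phi>] by auto
next
  case (Suc k)
  let ?D = "\<lambda>x v. \<Sum>e\<in>Basis. frechet_derivative (\<lambda>x. \<phi> x \<bullet> e) (at x) v *\<^sub>R e"
  have \<phi>: "(\<phi> has_derivative ?D x) (at x)" if "x \<in> U" for x
  proof -
    have "((\<lambda>x. \<Sum>e\<in>Basis. (\<phi> x \<bullet> e) *\<^sub>R e) has_derivative ?D x) (at x)"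
      using Suc.prems(1) that
      by (intro has_derivative_sum has_derivative_scaleR_left Ck_on_Suc_has_derivative) auto
    then show ?thesis by (simp add: euclidean_representation)
  qed
  show ?case
  proof (rule Ck_on_SucI[where f' = "\<lambda>x v. \<Sum>e\<in>Basis.
        frechet_derivative (\<lambda>x. \<phi> x \<bullet> e) (at x) v * frechet_derivative F (at (\<phi> x)) e"])
    fix x assume x: "x \<in> U"
    have F: "(F has_derivative frechet_derivative F (at (\<phi> x))) (at (\<phi> x))"
      using Ck_on_Suc_has_derivative Suc.prems(2) assms(2)[OF x] by blast
    have "(\<lambda>v. frechet_derivative F (at (\<phi> x)) (?D x v)) = (\<lambda>v. \<Sum>e\<in>Basis.
        frechet_derivative (\<lambda>x. \<phi> x \<bullet> e) (at x) v * frechet_derivative F (at (\<phi> x)) e)"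
      using has_derivative_linear[OF F] by (simp add: linear_sum linear_cmul)
    then show "((\<lambda>x. F (\<phi> x)) has_derivative (\<lambda>v. \<Sum>e\<in>Basis.
        frechet_derivative (\<lambda>x. \<phi> x \<bullet> e) (at x) v * frechet_derivative F (at (\<phi> x)) e)) (at x)"
      using has_derivative_compose[OF \<phi>[OF x] F] by simp
  next
    fix v
    have "Ck_on k (\<lambda>x. \<phi> x \<bullet> e) U" if "e \<in> Basis" for e
      using Suc.prems(1)[OF that] by (rule Ck_on_SucD)
    then show "Ck_on k (\<lambda>x. \<Sum>e\<in>Basis.
        frechet_derivative (\<lambda>x. \<phi> x \<bullet> e) (at x) v * frechet_derivative F (at (\<phi> x)) e) U"
      using Suc.prems by (intro Ck_on_sum Ck_on_mult assms(1)
          Suc.IH[of "\<lambda>y. frechet_derivative F (at y) _"]) auto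
  qed (rule assms(1))
qed

lemma Ck_on_compose_real:
  fixes \<phi> :: "'a::real_normed_vector \<Rightarrow> real"
  assumes "open U" "\<And>x. x \<in> U \<Longrightarrow> \<phi> x \<in> V" "Ck_on k \<phi> U" "Ck_on k F V"
  shows "Ck_on k (\<lambda>x. F (\<phi> x)) U"
  by (rule Ck_on_compose[OF assms(1), of \<phi> V]) (use assms in auto)

text \<open>Differentiation lowers the exponent, hence the induction for all \<open>a\<close> at
  once.\<close>

lemma Ck_on_powr: "Ck_on k (\<lambda>x::real. x powr a) {0<..}"
proof (induction k arbitrary: a)
  case (Suc k)
  show ?case
  proof (rule Ck_on_SucI[where f' = "\<lambda>x v. (v * a) * x powr (a - 1)"])
    show "((\<lambda>x::real. x powr a) has_derivative (\<lambda>v. (v * a) * x powr (a - 1))) (at x)" if "x \<in> {0<..}" for x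
      using that has_real_derivative_powr[of x a]
      by (auto simp: has_field_derivative_def elim!: has_derivative_eq_rhs)
  qed (auto intro!: Ck_on_mult Ck_on_const Suc)
qed (auto intro!: continuous_intros)

text \<open>Each of the two functions is the derivative of the other up to sign, so one induction
  has to carry both.\<close>

lemma Ck_on_sin_cos: "Ck_on k (sin :: real \<Rightarrow> real) UNIV \<and> Ck_on k (cos :: real \<Rightarrow> real) UNIV"
proof (induction k)
  case (Suc k)
  have "Ck_on (Suc k) (sin :: real \<Rightarrow> real) UNIV"
  proof (rule Ck_on_SucI[where f' = "\<lambda>x v. v * cos x"])
    show "(sin has_derivative (\<lambda>v. v * cos x)) (at x)" for x :: real
      using DERIV_sin[of x] by (auto simp: has_field_derivative_def elim!: has_derivative_eq_rhs)
  qed (use Suc in \<open>auto intro!: Ck_on_mult Ck_on_const\<close>)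
  moreover have "Ck_on (Suc k) (cos :: real \<Rightarrow> real) UNIV"
  proof (rule Ck_on_SucI[where f' = "\<lambda>x v. v * (- 1 * sin x)"])
    show "(cos has_derivative (\<lambda>v. v * (- 1 * sin x))) (at x)" for x :: real
      using DERIV_cos[of x] by (auto simp: has_field_derivative_def elim!: has_derivative_eq_rhs)
  qed (intro Ck_on_mult Ck_on_const open_UNIV | simp add: Suc)+
  ultimately show ?case ..
qed (auto intro!: continuous_intros)

lemma Ck_on_inner_self:
  "open U \<Longrightarrow> Ck_on k (\<lambda>x::'a::euclidean_space. x \<bullet> x) U"
  by (subst euclidean_inner)
    (intro Ck_on_sum Ck_on_mult Ck_on_linear bounded_linear_inner_left; assumption)

text \<open>Reduces the retraction to a quadratic form and a real power, whose regularity is known;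
  at 0 both sides vanish.\<close>

lemma sgn_eq_powr: "sgn x = (x \<bullet> x) powr (- 1 / 2) *\<^sub>R x" for x :: "'a::real_inner"
  by (simp add: sgn_div_norm norm_eq_sqrt_inner powr_minus powr_half_sqrt)

lemma Ck_on_sgn:
  "Ck_on k (\<lambda>x::'a::euclidean_space. sgn x \<bullet> e) (- {0})"
proof -
  have "Ck_on k (\<lambda>x::'a. (x \<bullet> x) powr (- 1 / 2) * (x \<bullet> e)) (- {0})"
    by (intro Ck_on_mult Ck_on_linear bounded_linear_inner_left
        Ck_on_compose_real[OF _ _ Ck_on_inner_self Ck_on_powr]) auto
  then show ?thesis by (simp add: sgn_eq_powr)
qed

lemma sgn_sphere: "x \<in> S2 \<Longrightarrow> sgn x = x"
  by (simp add: sgn_div_norm)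

lemma sgn_in_sphere: "x \<noteq> 0 \<Longrightarrow> sgn x \<in> S2"
  by (simp add: norm_sgn)

text \<open>Composition with \<open>sgn\<close> turns an arbitrary smooth extension into the one
  that is constant along rays. Smoothness thus becomes a property of one fixed function, the form in
  which it is mostly used below.\<close>

lemma smooth_on_sphere_iff:
  "smooth_on f S2 \<longleftrightarrow> (\<forall>k. Ck_on k (\<lambda>y. f (sgn y)) (- {0}))"
proof
  assume "smooth_on f S2"
  then obtain U F where U: "open U" "S2 \<subseteq> U" "\<And>k. Ck_on k F U" "\<And>x. x \<in> S2 \<Longrightarrow> F x = f x"
    unfolding smooth_on_def by blast
  show "\<forall>k. Ck_on k (\<lambda>y. f (sgn y)) (- {0})"
  proof
    fix k
    have "Ck_on k (\<lambda>y. F (sgn y)) (- {0})"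
      by (rule Ck_on_compose[of _ sgn U, OF _ _ Ck_on_sgn U(3)]) (use U(2) sgn_in_sphere in auto)
    then show "Ck_on k (\<lambda>y. f (sgn y)) (- {0})"
      by (rule Ck_on_cong[rotated 2]) (use U(4) sgn_in_sphere in auto)
  qed
next
  assume "\<forall>k. Ck_on k (\<lambda>y. f (sgn y)) (- {0})"
  moreover have "\<forall>x\<in>S2. f (sgn x) = f x"
    by (simp add: sgn_div_norm)
  moreover have "open (- {0 :: real ^ 3})" "S2 \<subseteq> - {0}"
    by auto
  ultimately show "smooth_on f S2"
    unfolding smooth_on_def
    by (intro exI[of _ "- {0}"] exI[of _ "\<lambda>y. f (sgn y)"] conjI)
qed

section \<open>Second derivatives: bilinearity, differentiation along curves, continuity\<close>

definition hess :: "('a::real_normed_vector \<Rightarrow> real) \<Rightarrow> 'a \<Rightarrow> 'a \<Rightarrow> 'a \<Rightarrow> real" where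
  "hess h x u v = frechet_derivative (\<lambda>y. frechet_derivative h (at y) u) (at x) v"

lemma Ck_on_continuous: "Ck_on k f U \<Longrightarrow> continuous_on U f"
  by (cases k) (auto intro: Ck_on_Suc_continuous)

context
  fixes h :: "'a::euclidean_space \<Rightarrow> real" and U
  assumes U: "open U" and h: "Ck_on 2 h U"
begin

lemma C2_has_derivative: "x \<in> U \<Longrightarrow> (h has_derivative frechet_derivative h (at x)) (at x)"
  using h by (auto simp: numeral_2_eq_2 frechet_derivative_works)

lemma C2_has_derivative2:
  "x \<in> U \<Longrightarrow> ((\<lambda>y. frechet_derivative h (at y) u) has_derivative hess h x u) (at x)"
  using h unfolding hess_def by (auto simp: numeral_2_eq_2 frechet_derivative_works)

lemma C2_linear: "x \<in> U \<Longrightarrow> linear (frechet_derivative h (at x))"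
  using C2_has_derivative has_derivative_linear by blast

lemma linear_hess: "x \<in> U \<Longrightarrow> linear (hess h x u)"
  using C2_has_derivative2 has_derivative_linear by blast

text \<open>The first derivative is linear in \<open>u\<close> at all points of the open set, and
  this identity between functions is then differentiated at \<open>x\<close>.\<close>

lemma linear_hess':
  assumes x: "x \<in> U"
  shows "linear (\<lambda>u. hess h x u v)"
proof
  fix u u' c
  have "((\<lambda>y. frechet_derivative h (at y) u + frechet_derivative h (at y) u')
      has_derivative (\<lambda>v. hess h x u v + hess h x u' v)) (at x)"
    by (intro has_derivative_add C2_has_derivative2 x)
  then have "((\<lambda>y. frechet_derivative h (at y) (u + u'))
      has_derivative (\<lambda>v. hess h x u v + hess h x u' v)) (at x)"
    by (rule has_derivative_transform_within_open[OF _ U x]) (simp add: C2_linear linear_add)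
  then show "hess h x (u + u') v = hess h x u v + hess h x u' v"
    unfolding hess_def[of h x "u + u'"] by (simp add: frechet_derivative_at[symmetric])
  have "((\<lambda>y. c *\<^sub>R frechet_derivative h (at y) u)
      has_derivative (\<lambda>v. c *\<^sub>R hess h x u v)) (at x)"
    by (intro has_derivative_scaleR_right C2_has_derivative2 x)
  then have "((\<lambda>y. frechet_derivative h (at y) (c *\<^sub>R u))
      has_derivative (\<lambda>v. c *\<^sub>R hess h x u v)) (at x)"
    by (rule has_derivative_transform_within_open[OF _ U x]) (simp add: C2_linear linear_cmul)
  then show "hess h x (c *\<^sub>R u) v = c *\<^sub>R hess h x u v"
    unfolding hess_def[of h x "c *\<^sub>R u"] by (simp add: frechet_derivative_at[symmetric])
qed

lemma C2_derivative_expand: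
  "x \<in> U \<Longrightarrow> frechet_derivative h (at x) w = (\<Sum>e\<in>Basis. (w \<bullet> e) * frechet_derivative h (at x) e)"
  by (subst euclidean_representation[symmetric, of w])
    (simp add: C2_linear linear_sum linear_cmul del: euclidean_representation)

lemma hess_expand:
  assumes "x \<in> U"
  shows "hess h x u v = (\<Sum>e\<in>Basis. (u \<bullet> e) * hess h x e v)"
    and "hess h x u v = (\<Sum>e\<in>Basis. (v \<bullet> e) * hess h x u e)"
proof -
  show "hess h x u v = (\<Sum>e\<in>Basis. (u \<bullet> e) * hess h x e v)"
    by (subst euclidean_representation[symmetric, of u])
      (simp add: linear_hess'[OF assms, THEN linear_sum] linear_hess'[OF assms, THEN linear_cmul]
        del: euclidean_representation)
  show "hess h x u v = (\<Sum>e\<in>Basis. (v \<bullet> e) * hess h x u e)"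
    by (subst euclidean_representation[symmetric, of v])
      (simp add: linear_hess[OF assms, THEN linear_sum] linear_hess[OF assms, THEN linear_cmul]
        del: euclidean_representation)
qed

lemma C2_curve:
  assumes "(\<gamma> has_vector_derivative v) (at s)" "\<gamma> s \<in> U"
  shows "((\<lambda>s. h (\<gamma> s)) has_real_derivative frechet_derivative h (at (\<gamma> s)) v) (at s)"
proof -
  have "((\<lambda>s. h (\<gamma> s)) has_vector_derivative frechet_derivative h (at (\<gamma> s)) v) (at s)"
    using vector_derivative_diff_chain_within[of \<gamma> v s UNIV h] assms C2_has_derivative
    by (auto simp: o_def has_derivative_at_withinI)
  then show ?thesis by (simp add: has_real_derivative_iff_has_vector_derivative)
qed

text \<open>The direction \<open>w s\<close> moves along with the curve. Expanding it in the basis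
  leaves only products of scalars to differentiate; one term sees the motion of the point, the other
  that of the direction.\<close>

lemma C2_curve2:
  assumes "(\<gamma> has_vector_derivative v) (at s)" "(w has_vector_derivative w') (at s)"
    and \<gamma>: "\<And>s. \<gamma> s \<in> U"
  shows "((\<lambda>s. frechet_derivative h (at (\<gamma> s)) (w s)) has_real_derivative
     hess h (\<gamma> s) (w s) v + frechet_derivative h (at (\<gamma> s)) w') (at s)"
proof -
  have *: "((\<lambda>s. frechet_derivative h (at (\<gamma> s)) e) has_real_derivative hess h (\<gamma> s) e v) (at s)" for e
  proof -
    have "((\<lambda>s. frechet_derivative h (at (\<gamma> s)) e) has_vector_derivative hess h (\<gamma> s) e v) (at s)"
      using vector_derivative_diff_chain_within[OF assms(1),
          of "\<lambda>y. frechet_derivative h (at y) e"] C2_has_derivative2[OF \<gamma>]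
      by (auto simp: o_def has_derivative_at_withinI)
    then show ?thesis by (simp add: has_real_derivative_iff_has_vector_derivative)
  qed
  have w: "((\<lambda>s. w s \<bullet> e) has_real_derivative w' \<bullet> e) (at s)" for e
    using bounded_linear.has_vector_derivative[OF bounded_linear_inner_left assms(2)]
    by (simp add: has_real_derivative_iff_has_vector_derivative)
  have "((\<lambda>s. \<Sum>e\<in>Basis. (w s \<bullet> e) * frechet_derivative h (at (\<gamma> s)) e) has_real_derivative
     (\<Sum>e\<in>Basis. (w' \<bullet> e) * frechet_derivative h (at (\<gamma> s)) e + hess h (\<gamma> s) e v * (w s \<bullet> e))) (at s)"
    by (intro DERIV_sum DERIV_mult * w)
  then show ?thesis
    using \<gamma> by (simp add: C2_derivative_expand[of _ "w _"] C2_derivative_expand[of _ w']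
        hess_expand(1)[of _ "w _"] sum.distrib mult.commute add.commute)
qed

lemma continuous_on_C2_derivative:
  assumes "continuous_on A \<gamma>" "continuous_on A u" "\<And>s. s \<in> A \<Longrightarrow> \<gamma> s \<in> U"
  shows "continuous_on A (\<lambda>s. frechet_derivative h (at (\<gamma> s)) (u s))"
proof -
  have "continuous_on U (\<lambda>x. frechet_derivative h (at x) e)" for e
    using h Ck_on_continuous[of "Suc 0" _ U] unfolding numeral_2_eq_2 Ck_on.simps(2)[of "Suc 0"] by blast
  then have "continuous_on A (\<lambda>s. frechet_derivative h (at (\<gamma> s)) e)" for e
    by (rule continuous_on_compose2) (use assms in auto)
  then have "continuous_on A (\<lambda>s. \<Sum>e\<in>Basis. (u s \<bullet> e) * frechet_derivative h (at (\<gamma> s)) e)"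
    by (intro continuous_intros assms)
  then show ?thesis
    by (rule continuous_on_eq) (simp add: C2_derivative_expand[symmetric] assms)
qed

lemma continuous_on_hess:
  assumes "continuous_on A \<gamma>" "continuous_on A u" "continuous_on A v" "\<And>s. s \<in> A \<Longrightarrow> \<gamma> s \<in> U"
  shows "continuous_on A (\<lambda>s. hess h (\<gamma> s) (u s) (v s))"
proof -
  have "continuous_on U (\<lambda>x. hess h x e e')" for e e'
    using h by (auto simp: numeral_2_eq_2 hess_def)
  then have "continuous_on A (\<lambda>s. hess h (\<gamma> s) e e')" for e e'
    by (rule continuous_on_compose2) (use assms in auto)
  then have "continuous_on A (\<lambda>s. \<Sum>e'\<in>Basis. \<Sum>e\<in>Basis. (v s \<bullet> e') * ((u s \<bullet> e) * hess h (\<gamma> s) e e'))"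
    by (intro continuous_intros assms)
  then show ?thesis
    by (rule continuous_on_eq)
      (simp add: hess_expand(1)[OF assms(4), of _ "u _"] hess_expand(2)[OF assms(4), of _ _ "v _"]
        sum_distrib_left)
qed

end

text \<open>Expanding \<open>B\<close> in the basis leaves the Gram sums of the vectors
  \<open>R e\<close>, and these form the identity. Invariance of the trace lets the Laplacian be
  read in a spherical frame and carried along rotations.\<close>

lemma sum_Basis_orthogonal_transformation:
  fixes B :: "'a::euclidean_space \<Rightarrow> 'a \<Rightarrow> real" and R :: "'a \<Rightarrow> 'a"
  assumes R: "orthogonal_transformation R"
    and B: "\<And>v. linear (\<lambda>u. B u v)" "\<And>u. linear (B u)"
  shows "(\<Sum>e\<in>Basis. B (R e) (R e)) = (\<Sum>e\<in>Basis. B e e)"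
proof -
  have iso: "R a \<bullet> R b = a \<bullet> b" for a b
    using R by (simp add: orthogonal_transformation_def)
  have expand: "B u v = (\<Sum>a\<in>Basis. \<Sum>b\<in>Basis. ((u \<bullet> a) * (v \<bullet> b)) * B a b)" for u v
  proof -
    have "B u v = B (\<Sum>a\<in>Basis. (u \<bullet> a) *\<^sub>R a) (\<Sum>b\<in>Basis. (v \<bullet> b) *\<^sub>R b)"
      by (simp only: euclidean_representation)
    also have "\<dots> = (\<Sum>a\<in>Basis. (u \<bullet> a) * B a (\<Sum>b\<in>Basis. (v \<bullet> b) *\<^sub>R b))"
      by (simp only: linear_sum[OF B(1)] linear_cmul[OF B(1)] real_scaleR_def)
    also have "\<dots> = (\<Sum>a\<in>Basis. \<Sum>b\<in>Basis. ((u \<bullet> a) * (v \<bullet> b)) * B a b)"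
      by (simp only: linear_sum[OF B(2)] linear_cmul[OF B(2)] sum_distrib_left real_scaleR_def mult.assoc)
    finally show ?thesis .
  qed
  have surjR: "surj R"
    using linear_injective_imp_surjective[of R] orthogonal_transformation_inj[OF R]
      orthogonal_transformation_linear[OF R] by simp
  \<comment> \<open>This is \<open>R R^T = I\<close>: pulling \<open>a\<close> and \<open>b\<close>
    back through \<open>R\<close> turns the left side into Parseval's identity for the standard
    basis.\<close>
  have orth: "(\<Sum>e\<in>Basis. (R e \<bullet> a) * (R e \<bullet> b)) = a \<bullet> b" for a b
  proof -
    obtain a' where a': "a = R a'" using surjD[OF surjR] by blast
    obtain b' where b': "b = R b'" using surjD[OF surjR] by blast
    have "(\<Sum>e\<in>Basis. (e \<bullet> a') * (e \<bullet> b')) = a' \<bullet> b'"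
      unfolding euclidean_inner[of a' b'] by (simp add: inner_commute)
    then show ?thesis
      by (simp only: a' b' iso)
  qed
  have "(\<Sum>e\<in>Basis. B (R e) (R e)) =
      (\<Sum>e\<in>Basis. \<Sum>a\<in>Basis. \<Sum>b\<in>Basis. ((R e \<bullet> a) * (R e \<bullet> b)) * B a b)"
    by (intro sum.cong refl expand)
  also have "\<dots> = (\<Sum>a\<in>Basis. \<Sum>e\<in>Basis. \<Sum>b\<in>Basis. ((R e \<bullet> a) * (R e \<bullet> b)) * B a b)"
    by (rule sum.swap)
  also have "\<dots> = (\<Sum>a\<in>Basis. \<Sum>b\<in>Basis. \<Sum>e\<in>Basis. ((R e \<bullet> a) * (R e \<bullet> b)) * B a b)"
    by (intro sum.cong refl sum.swap)
  also have "\<dots> = (\<Sum>a\<in>Basis. \<Sum>b\<in>Basis. (\<Sum>e\<in>Basis. (R e \<bullet> a) * (R e \<bullet> b)) * B a b)"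
    by (simp only: sum_distrib_right)
  also have "\<dots> = (\<Sum>a\<in>Basis. \<Sum>b\<in>Basis. (a \<bullet> b) * B a b)"
    by (simp only: orth)
  also have "\<dots> = (\<Sum>a\<in>Basis. \<Sum>b\<in>Basis. if a = b then B a b else 0)"
    by (intro sum.cong refl) (simp add: inner_Basis)
  also have "\<dots> = (\<Sum>e\<in>Basis. B e e)"
    by simp
  finally show ?thesis .
qed

subsection \<open>The Laplace-Beltrami operator and spherical coordinates\<close>

lemma vector_3_eq:
  "(vector [a, b, c] :: real ^ 3) = a *\<^sub>R axis 1 1 + b *\<^sub>R axis 2 1 + c *\<^sub>R axis 3 1"
  by (simp add: vec_eq_iff forall_3 axis_def)

lemma has_vector_derivative_vector_3:
  assumes "(a has_real_derivative a') (at s)" "(b has_real_derivative b') (at s)"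
    "(c has_real_derivative c') (at s)"
  shows "((\<lambda>s. vector [a s, b s, c s] :: real ^ 3) has_vector_derivative vector [a', b', c']) (at s)"
  unfolding vector_3_eq using assms
  by (auto intro!: has_vector_derivative_add has_vector_derivative_scaleR[THEN has_vector_derivative_eq_rhs])

lemma continuous_on_vector_3:
  assumes "continuous_on A a" "continuous_on A b" "continuous_on A c"
  shows "continuous_on A (\<lambda>s. vector [a s, b s, c s] :: real ^ 3)"
  unfolding vector_3_eq using assms by (intro continuous_intros)

lemma open_nonzero: "open (- {0 :: real ^ 3})"
  by auto

lemma sum_Basis_3:
  "(\<Sum>e\<in>(Basis :: (real ^ 3) set). g e) = g (axis 1 1) + g (axis 2 1) + g (axis 3 1)"
proof -
  have B: "(Basis :: (real ^ 3) set) = {axis 1 1, axis 2 1, axis 3 1}"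
    by (auto simp: Basis_vec_def UNIV_3)
  show ?thesis unfolding B by (simp add: axis_eq_axis add.assoc)
qed

lemma sgn_has_derivative:
  fixes x :: "'a::real_inner"
  assumes "norm x = 1"
  shows "(sgn has_derivative (\<lambda>v. v - (x \<bullet> v) *\<^sub>R x)) (at x)"
proof -
  have "x \<bullet> x = 1" using assms by (simp add: norm_eq_sqrt_inner)
  then have "((\<lambda>y. (y \<bullet> y) powr (- 1 / 2) *\<^sub>R y) has_derivative (\<lambda>v. v - (x \<bullet> v) *\<^sub>R x)) (at x)"
    by (auto intro!: derivative_eq_intros simp: inner_commute)
  then show ?thesis
    by (simp add: sgn_eq_powr[abs_def])
qed

lemma linear_sgn_derivative: "linear (\<lambda>v. v - (x \<bullet> v) *\<^sub>R x)" for x :: "'a::real_inner"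
  by (rule linearI) (simp_all add: inner_add_right algebra_simps)

section \<open>The Laplacian on the sphere as a Euclidean trace of the extension constant along
  rays\<close>

context
  fixes f :: "real ^ 3 \<Rightarrow> real" and h
  assumes smooth: "smooth_on f S2"
  defines "h \<equiv> \<lambda>y. f (sgn y)"
begin

lemma C2_radial: "Ck_on 2 h (- {0})"
  using smooth unfolding smooth_on_sphere_iff h_def by blast

lemmas has_derivative2_radial = C2_has_derivative2[OF open_nonzero C2_radial]
  and linear_radial = C2_linear[OF open_nonzero C2_radial]
  and linear_hess_radial = linear_hess[OF open_nonzero C2_radial]
  and linear_hess_radial' = linear_hess'[OF open_nonzero C2_radial]

text \<open>\<open>h\<close> is constant along rays. The ray is parametrised by
  \<open>exp s *\<^sub>R x\<close>, which never meets the origin and whose velocity equals its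
  position.\<close>

lemma radial_derivative_self:
  assumes "x \<noteq> 0"
  shows "frechet_derivative h (at x) x = 0"
proof -
  have d: "((\<lambda>s. exp s *\<^sub>R x) has_vector_derivative x) (at 0)"
    by (auto intro!: derivative_eq_intros)
  have "(\<lambda>s::real. h (exp s *\<^sub>R x)) = (\<lambda>s. h x)"
    by (simp add: h_def sgn_scaleR)
  then have "((\<lambda>s::real. h (exp s *\<^sub>R x)) has_real_derivative 0) (at 0)"
    by simp
  moreover have "((\<lambda>s::real. h (exp s *\<^sub>R x)) has_real_derivative frechet_derivative h (at x) x) (at 0)"
    using C2_curve[OF open_nonzero C2_radial d] assms by simp
  ultimately show ?thesis using DERIV_unique by blast
qed

text \<open>Differentiating \<open>radial_derivative_self\<close> along the same ray gives the
  second radial derivative plus the first one, which is already known to vanish.\<close>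

lemma hess_radial_self:
  assumes "x \<noteq> 0"
  shows "hess h x x x = 0"
proof -
  have d: "((\<lambda>s. exp s *\<^sub>R x) has_vector_derivative x) (at 0)"
    by (auto intro!: derivative_eq_intros)
  have "(\<lambda>s::real. frechet_derivative h (at (exp s *\<^sub>R x)) (exp s *\<^sub>R x)) = (\<lambda>s. 0)"
    using radial_derivative_self assms by simp
  then have "((\<lambda>s::real. frechet_derivative h (at (exp s *\<^sub>R x)) (exp s *\<^sub>R x)) has_real_derivative 0) (at 0)"
    by simp
  moreover have "((\<lambda>s::real. frechet_derivative h (at (exp s *\<^sub>R x)) (exp s *\<^sub>R x)) has_real_derivative
      hess h x x x + frechet_derivative h (at x) x) (at 0)"
    using C2_curve2[OF open_nonzero C2_radial d d] assms by simp
  ultimately have "hess h x x x + frechet_derivative h (at x) x = 0"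
    using DERIV_unique by blast
  then show ?thesis using radial_derivative_self assms by simp
qed

lemma grad_eq: "grad f x = (\<Sum>e\<in>Basis. frechet_derivative h (at x) e *\<^sub>R e)"
  by (simp add: grad_def sph_diff_def h_def)

lemma inner_grad:
  assumes "x \<noteq> 0"
  shows "grad f x \<bullet> v = frechet_derivative h (at x) v"
  using C2_derivative_expand[OF open_nonzero C2_radial, of x v] assms
  by (simp add: grad_eq inner_sum_left inner_sum_right inner_commute[of _ v] mult.commute)

text \<open>The radial second derivative vanishes, so the full trace is the tangential one.\<close>

lemma laplace_beltrami_eq:
  assumes "x \<in> S2"
  shows "laplace_beltrami f x = (\<Sum>e\<in>Basis. hess h x e e)"
proof -
  have x: "x \<noteq> 0" "norm x = 1" "x \<bullet> x = 1" using assms by (auto simp: norm_eq_sqrt_inner)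
  \<comment> \<open>\<open>P\<close> is the tangential projection, the derivative of
    \<open>sgn\<close> at \<open>x\<close>; \<open>W\<close> is the differential of the gradient
    field along the sphere.\<close>
  define P where "P = (\<lambda>v. v - (x \<bullet> v) *\<^sub>R x)"
  define W where "W = (\<lambda>v. \<Sum>e\<in>Basis. hess h x e (P v) *\<^sub>R e)"
  have linP: "linear P" unfolding P_def by (rule linear_sgn_derivative)
  have "linear (\<lambda>v. hess h x e (P v) *\<^sub>R e)" for e
    using linear_compose[OF linP linear_compose[OF linear_hess_radial linear_scaleR_left], of x e e] x(1)
    by (simp add: o_def)
  then have linW: "linear W"
    unfolding W_def by (intro linear_compose_sum ballI)
  have "((\<lambda>y. frechet_derivative h (at (sgn y)) e) has_derivative (\<lambda>v. hess h x e (P v))) (at x)" for e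
  proof -
    have "((\<lambda>y. frechet_derivative h (at y) e) has_derivative hess h x e) (at (sgn x))"
      using has_derivative2_radial x(1) sgn_sphere[OF assms] by simp
    from has_derivative_compose[OF sgn_has_derivative[OF x(2)] this]
    show ?thesis unfolding P_def .
  qed
  then have "((\<lambda>y. grad f (sgn y)) has_derivative W) (at x)"
    unfolding grad_eq W_def by (intro has_derivative_sum has_derivative_scaleR_left)
  then have sph: "sph_diff (grad f) x = W"
    unfolding sph_diff_def using frechet_derivative_at by (metis eta_contract_eq)
  \<comment> \<open>Replacing \<open>P e\<close> by \<open>e\<close> in the trace costs
    \<open>hess h x x x\<close>, which is 0.\<close>
  have 1: "(\<Sum>e\<in>Basis. W e \<bullet> e) = (\<Sum>e\<in>Basis. hess h x e e)"
  proof -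
    have "W e \<bullet> e = hess h x e e - (x \<bullet> e) * hess h x e x" if "e \<in> Basis" for e
    proof -
      have "W e \<bullet> e = hess h x e (P e)"
        unfolding W_def using that by (simp add: inner_sum_left inner_Basis if_distrib cong: if_cong)
      also have "\<dots> = hess h x e e - (x \<bullet> e) * hess h x e x"
        using x(1) unfolding P_def
        by (simp add: linear_diff[OF linear_hess_radial] linear_cmul[OF linear_hess_radial])
      finally show ?thesis .
    qed
    moreover have "(\<Sum>e\<in>Basis. (x \<bullet> e) * hess h x e x) = 0"
      using hess_expand(1)[OF open_nonzero C2_radial, of x x x] hess_radial_self x(1) by simp
    ultimately show ?thesis by (simp add: sum_subtractf)
  qed
  \<comment> \<open>The normal parts removed by \<open>cov_deriv\<close> add up to
    \<open>x \<bullet> W x\<close>, and \<open>W x = 0\<close> because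
    \<open>P x = 0\<close>.\<close>
  have 2: "(\<Sum>e\<in>Basis. (x \<bullet> W e) * (x \<bullet> e)) = 0"
  proof -
    have "(\<Sum>e\<in>Basis. (x \<bullet> W e) * (x \<bullet> e)) = x \<bullet> W (\<Sum>e\<in>Basis. (x \<bullet> e) *\<^sub>R e)"
      by (simp only: linear_sum[OF linW] linear_cmul[OF linW] inner_sum_right inner_scaleR_right mult.commute)
    also have "W (\<Sum>e\<in>Basis. (x \<bullet> e) *\<^sub>R e) = W x"
      by (simp only: euclidean_representation)
    also have "W x = 0"
      using x linear_0[OF linear_hess_radial] unfolding W_def P_def by simp
    finally show ?thesis by simp
  qed
  show ?thesis
    using 1 2 by (simp add: laplace_beltrami_def sph_div_def cov_deriv_def sph inner_diff_left sum_subtractf)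
qed


lemma laplace_beltrami_orthogonal:
  fixes R :: "real ^ 3 \<Rightarrow> real ^ 3"
  assumes "orthogonal_transformation R" "x \<in> S2"
  shows "laplace_beltrami f x = (\<Sum>e\<in>Basis. hess h x (R e) (R e))"
proof -
  have "x \<in> - {0}" using assms(2) by auto
  then show ?thesis
    using laplace_beltrami_eq[OF assms(2)] sum_Basis_orthogonal_transformation[OF assms(1)
        linear_hess_radial' linear_hess_radial] by simp
qed

end

section \<open>Coordinate vectors and orthonormal frames in spherical coordinates\<close>

abbreviation sph where "sph \<phi> \<theta> \<equiv> sph_coord (\<phi>, \<theta>)"

definition sph_\<theta> :: "real \<Rightarrow> real \<Rightarrow> real ^ 3" where
  "sph_\<theta> \<phi> \<theta> = vector [- sin \<theta> * cos \<phi>, - sin \<theta> * sin \<phi>, cos \<theta>]"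

text \<open>Not normalised: the length is the absolute value of \<open>cos \<theta>\<close>, so the
  vector vanishes at the poles, while at \<open>\<theta> = 0\<close> it is the unit eastward
  vector.\<close>

definition sph_\<phi> :: "real \<Rightarrow> real \<Rightarrow> real ^ 3" where
  "sph_\<phi> \<phi> \<theta> = vector [- cos \<theta> * sin \<phi>, cos \<theta> * cos \<phi>, 0]"

definition sph_\<phi>\<phi> :: "real \<Rightarrow> real \<Rightarrow> real ^ 3" where
  "sph_\<phi>\<phi> \<phi> \<theta> = vector [- cos \<theta> * cos \<phi>, - cos \<theta> * sin \<phi>, 0]"

lemma sph_in_sphere: "sph \<phi> \<theta> \<in> S2"
proof -
  have "(cos \<theta> * cos \<phi>)\<^sup>2 + (cos \<theta> * sin \<phi>)\<^sup>2 = (cos \<theta>)\<^sup>2"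
    by (simp add: power_mult_distrib flip: distrib_left)
  then show ?thesis
    by (simp add: sph_coord_def norm_vec_def L2_set_def sum_3 power2_eq_square[symmetric])
qed

lemma sph_nonzero: "sph \<phi> \<theta> \<noteq> 0"
  using sph_in_sphere[of \<phi> \<theta>] by auto

text \<open>Meridians are great circles of unit speed, so their acceleration is minus the
  position.\<close>

lemma sph_derivatives:
  "(sph \<phi> has_vector_derivative sph_\<theta> \<phi> \<theta>) (at \<theta>)"
  "((\<lambda>\<phi>. sph \<phi> \<theta>) has_vector_derivative sph_\<phi> \<phi> \<theta>) (at \<phi>)"
  "(sph_\<theta> \<phi> has_vector_derivative - sph \<phi> \<theta>) (at \<theta>)"
  "((\<lambda>\<phi>. sph_\<phi> \<phi> \<theta>) has_vector_derivative sph_\<phi>\<phi> \<phi> \<theta>) (at \<phi>)"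
proof -
  have neg: "- sph \<phi> \<theta> = vector [- cos \<theta> * cos \<phi>, - cos \<theta> * sin \<phi>, - sin \<theta>]"
    by (simp add: sph_coord_def vec_eq_iff forall_3)
  show "(sph \<phi> has_vector_derivative sph_\<theta> \<phi> \<theta>) (at \<theta>)"
    "((\<lambda>\<phi>. sph \<phi> \<theta>) has_vector_derivative sph_\<phi> \<phi> \<theta>) (at \<phi>)"
    "(sph_\<theta> \<phi> has_vector_derivative - sph \<phi> \<theta>) (at \<theta>)"
    "((\<lambda>\<phi>. sph_\<phi> \<phi> \<theta>) has_vector_derivative sph_\<phi>\<phi> \<phi> \<theta>) (at \<phi>)"
    unfolding neg
    unfolding sph_coord_def sph_\<theta>_def[abs_def] sph_\<phi>_def sph_\<phi>\<phi>_def prod.case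
    by (auto intro!: has_vector_derivative_vector_3 derivative_eq_intros)
qed

lemma sph_continuous:
  "continuous_on A (\<lambda>s. sph (fst s) (snd s))"
  "continuous_on A (\<lambda>s. sph_\<theta> (fst s) (snd s))"
  "continuous_on A (\<lambda>s. sph_\<phi> (fst s) (snd s))"
  "continuous_on A (\<lambda>s. sph_\<phi>\<phi> (fst s) (snd s))"
  unfolding sph_coord_def sph_\<theta>_def sph_\<phi>_def sph_\<phi>\<phi>_def prod.case
  by (intro continuous_on_vector_3 continuous_intros)+

text \<open>A parallel other than the equator is not a geodesic: its acceleration has a component
  along the meridian, which makes a first-order term appear in the second longitudinal
  derivative.\<close>

lemma sph_\<phi>\<phi>_eq:
  "sph_\<phi>\<phi> \<phi> \<theta> = (cos \<theta> * sin \<theta>) *\<^sub>R sph_\<theta> \<phi> \<theta> - (cos \<theta>)\<^sup>2 *\<^sub>R sph \<phi> \<theta>"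
proof -
  have 1: "cos \<theta> * cos \<theta> + sin \<theta> * sin \<theta> = 1"
    by (simp flip: power2_eq_square)
  have "- cos \<theta> * cos \<phi> = cos \<theta> * sin \<theta> * (- sin \<theta> * cos \<phi>) - (cos \<theta>)\<^sup>2 * (cos \<theta> * cos \<phi>)"
    "- cos \<theta> * sin \<phi> = cos \<theta> * sin \<theta> * (- sin \<theta> * sin \<phi>) - (cos \<theta>)\<^sup>2 * (cos \<theta> * sin \<phi>)"
    using 1 by algebra+
  then show ?thesis
    by (simp add: sph_coord_def vec_eq_iff forall_3 sph_\<theta>_def sph_\<phi>\<phi>_def power2_eq_square)
qed

text \<open>The eastward vector is \<open>sph_\<phi> \<phi> 0\<close> rather than
  \<open>sph_\<phi> \<phi> \<theta>\<close>, which keeps the frame orthonormal at the poles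
  too.\<close>

definition sph_frame :: "real \<Rightarrow> real \<Rightarrow> real ^ 3 \<Rightarrow> real ^ 3" where
  "sph_frame \<phi> \<theta> v =
     v $ 1 *\<^sub>R sph_\<phi> \<phi> 0 + v $ 2 *\<^sub>R sph_\<theta> \<phi> \<theta> + v $ 3 *\<^sub>R sph \<phi> \<theta>"

lemma orthogonal_transformation_sph_frame: "orthogonal_transformation (sph_frame \<phi> \<theta>)"
  unfolding orthogonal_transformation_def
proof
  show "linear (sph_frame \<phi> \<theta>)"
    by (rule linearI) (simp_all add: sph_frame_def algebra_simps)
  let ?u = "sph_\<phi> \<phi> 0" and ?v = "sph_\<theta> \<phi> \<theta>" and ?w = "sph \<phi> \<theta>"
  have 1: "?w \<bullet> ?w = 1" "?u \<bullet> ?u = 1"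
    using sph_in_sphere[of \<phi> \<theta>]
    by (simp_all add: norm_eq_sqrt_inner sph_\<phi>_def inner_vec_def sum_3 power2_eq_square[symmetric])
  have "(sin \<theta> * cos \<phi>)\<^sup>2 + (sin \<theta> * sin \<phi>)\<^sup>2 = (sin \<theta>)\<^sup>2"
    by (simp add: power_mult_distrib flip: distrib_left)
  then have 2: "?v \<bullet> ?v = 1"
    by (simp add: sph_\<theta>_def inner_vec_def sum_3 power2_eq_square[symmetric])
  have 3: "?u \<bullet> ?v = 0" "?u \<bullet> ?w = 0"
    by (simp_all add: sph_coord_def sph_\<phi>_def sph_\<theta>_def inner_vec_def sum_3)
  have "cos \<phi> * cos \<phi> + sin \<phi> * sin \<phi> = 1"
    by (simp flip: power2_eq_square)
  moreover have "?v \<bullet> ?w = (- sin \<theta> * cos \<phi>) * (cos \<theta> * cos \<phi>)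
      + (- sin \<theta> * sin \<phi>) * (cos \<theta> * sin \<phi>) + cos \<theta> * sin \<theta>"
    by (simp add: sph_coord_def sph_\<theta>_def inner_vec_def sum_3)
  ultimately have 4: "?v \<bullet> ?w = 0" by algebra
  show "\<forall>a b. sph_frame \<phi> \<theta> a \<bullet> sph_frame \<phi> \<theta> b = a \<bullet> b"
  proof (intro allI)
    fix a b :: "real ^ 3"
    have "a \<bullet> b = a $ 1 * b $ 1 + a $ 2 * b $ 2 + a $ 3 * b $ 3"
      by (simp add: inner_vec_def sum_3)
    then show "sph_frame \<phi> \<theta> a \<bullet> sph_frame \<phi> \<theta> b = a \<bullet> b"
      using 1 2 3 4
      by (simp add: sph_frame_def inner_add_left inner_add_right inner_commute[of ?v ?u]
          inner_commute[of ?w ?u] inner_commute[of ?w ?v])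
  qed
qed


section \<open>The Laplacian in divergence form and its vanishing integral\<close>

context
  fixes f :: "real ^ 3 \<Rightarrow> real" and h
  assumes smooth: "smooth_on f S2"
  defines "h \<equiv> \<lambda>y. f (sgn y)"
begin

definition "merid_deriv \<phi> \<theta> = frechet_derivative h (at (sph \<phi> \<theta>)) (sph_\<theta> \<phi> \<theta>)"

definition "lat_deriv \<phi> \<theta> = frechet_derivative h (at (sph \<phi> \<theta>)) (sph_\<phi> \<phi> \<theta>)"

text \<open>The two terms of the divergence form, in coordinates: \<open>merid_part\<close> is the
  \<theta>-derivative of \<open>cos \<theta>\<close> times the \<theta>-derivative of
  \<open>f\<close>, and \<open>lat_part\<close> is the second \<phi>-derivative of
  \<open>f\<close>.\<close>

definition "merid_part \<phi> \<theta> =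
  cos \<theta> * hess h (sph \<phi> \<theta>) (sph_\<theta> \<phi> \<theta>) (sph_\<theta> \<phi> \<theta>) - sin \<theta> * merid_deriv \<phi> \<theta>"

definition "lat_part \<phi> \<theta> =
  hess h (sph \<phi> \<theta>) (sph_\<phi> \<phi> \<theta>) (sph_\<phi> \<phi> \<theta>)
    + frechet_derivative h (at (sph \<phi> \<theta>)) (sph_\<phi>\<phi> \<phi> \<theta>)"

lemma C2_h: "Ck_on 2 h (- {0})"
  using C2_radial[OF smooth] unfolding h_def .

text \<open>The acceleration of a meridian is radial, so it contributes nothing to the second
  derivative.\<close>

lemma merid_part_derivative:
  "((\<lambda>\<theta>. cos \<theta> * merid_deriv \<phi> \<theta>) has_real_derivative merid_part \<phi> \<theta>) (at \<theta>)"
proof -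
  have "(merid_deriv \<phi> has_real_derivative
      hess h (sph \<phi> \<theta>) (sph_\<theta> \<phi> \<theta>) (sph_\<theta> \<phi> \<theta>)
        + frechet_derivative h (at (sph \<phi> \<theta>)) (- sph \<phi> \<theta>)) (at \<theta>)"
    unfolding merid_deriv_def[abs_def]
    by (rule C2_curve2[OF open_nonzero C2_h sph_derivatives(1,3)]) (simp add: sph_nonzero)
  also have "frechet_derivative h (at (sph \<phi> \<theta>)) (- sph \<phi> \<theta>) = 0"
    using linear_neg[OF linear_radial[OF smooth]] radial_derivative_self[OF smooth] sph_nonzero
    by (simp add: h_def)
  finally have "(merid_deriv \<phi> has_real_derivative
      hess h (sph \<phi> \<theta>) (sph_\<theta> \<phi> \<theta>) (sph_\<theta> \<phi> \<theta>)) (at \<theta>)"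
    by simp
  then show ?thesis
    unfolding merid_part_def by (auto intro!: derivative_eq_intros)
qed

lemma lat_part_derivative:
  "((\<lambda>\<phi>. lat_deriv \<phi> \<theta>) has_real_derivative lat_part \<phi> \<theta>) (at \<phi>)"
  unfolding lat_deriv_def lat_part_def
  by (rule C2_curve2[OF open_nonzero C2_h sph_derivatives(2,4)]) (simp add: sph_nonzero)

text \<open>The trace is taken in \<open>sph_frame\<close>, where the radial direction contributes
  0, and the first-order terms of \<open>merid_part\<close> and \<open>lat_part\<close> cancel. The
  factor \<open>(cos \<theta>)\<^sup>2\<close> makes the identity hold at the poles.\<close>

lemma laplace_beltrami_sph:
  "(cos \<theta>)\<^sup>2 * laplace_beltrami f (sph \<phi> \<theta>) = cos \<theta> * merid_part \<phi> \<theta> + lat_part \<phi> \<theta>"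
proof -
  let ?x = "sph \<phi> \<theta>"
  let ?H = "hess h ?x" and ?R = "sph_frame \<phi> \<theta>"
  have x: "?x \<in> - {0}" by (simp add: sph_nonzero)
  have R: "?R (axis 1 1) = sph_\<phi> \<phi> 0" "?R (axis 2 1) = sph_\<theta> \<phi> \<theta>" "?R (axis 3 1) = ?x"
    by (simp_all add: sph_frame_def axis_def)
  have 1: "laplace_beltrami f ?x =
      ?H (sph_\<phi> \<phi> 0) (sph_\<phi> \<phi> 0) + ?H (sph_\<theta> \<phi> \<theta>) (sph_\<theta> \<phi> \<theta>)"
    using laplace_beltrami_orthogonal[OF smooth orthogonal_transformation_sph_frame sph_in_sphere,
        of \<phi> \<theta> \<phi> \<theta>] hess_radial_self[OF smooth, of ?x]
    by (simp add: sum_Basis_3 R sph_nonzero h_def)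
  have "sph_\<phi> \<phi> \<theta> = cos \<theta> *\<^sub>R sph_\<phi> \<phi> 0"
    by (simp add: sph_\<phi>_def vec_eq_iff forall_3)
  then have 2: "?H (sph_\<phi> \<phi> \<theta>) (sph_\<phi> \<phi> \<theta>) = (cos \<theta>)\<^sup>2 * ?H (sph_\<phi> \<phi> 0) (sph_\<phi> \<phi> 0)"
    using linear_cmul[OF linear_hess[OF open_nonzero C2_h x]]
      linear_cmul[OF linear_hess'[OF open_nonzero C2_h x]]
    by (simp add: power2_eq_square)
  have 3: "frechet_derivative h (at ?x) (sph_\<phi>\<phi> \<phi> \<theta>) = cos \<theta> * sin \<theta> * merid_deriv \<phi> \<theta>"
    using linear_diff[OF C2_linear[OF open_nonzero C2_h x]]
      linear_cmul[OF C2_linear[OF open_nonzero C2_h x]] radial_derivative_self[OF smooth, of ?x]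
    by (simp add: sph_\<phi>\<phi>_eq merid_deriv_def sph_nonzero h_def)
  show ?thesis
    unfolding 1 lat_part_def 2 3 merid_part_def by (simp add: algebra_simps power2_eq_square)
qed

lemma continuous_on_merid_part: "continuous_on A (\<lambda>s. merid_part (fst s) (snd s))"
  unfolding merid_part_def merid_deriv_def
  by (intro continuous_intros continuous_on_hess[OF open_nonzero C2_h]
      continuous_on_C2_derivative[OF open_nonzero C2_h] sph_continuous) (auto simp: sph_nonzero)

text \<open>Away from the poles the integrand is \<open>merid_part\<close> plus
  \<open>lat_part\<close> divided by \<open>cos \<theta>\<close>. The latter integrates to 0 over a
  period in \<phi>; the former, after exchanging the integrals, because \<open>cos \<theta>\<close>
  vanishes at both ends of a meridian.\<close>

lemma integral_laplace_beltrami_sph: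
  "integral {- pi / 2..pi / 2} (\<lambda>\<theta>. integral {0..2 * pi} (\<lambda>\<phi>. cos \<theta> * laplace_beltrami f (sph \<phi> \<theta>))) = 0"
proof -
  have lat: "((\<lambda>\<phi>. lat_part \<phi> \<theta>) has_integral 0) {0..2 * pi}" for \<theta>
  proof -
    have "((\<lambda>\<phi>. lat_part \<phi> \<theta>) has_integral (lat_deriv (2 * pi) \<theta> - lat_deriv 0 \<theta>)) {0..2 * pi}"
      by (intro fundamental_theorem_of_calculus)
        (auto intro: lat_part_derivative has_field_derivative_at_within
          simp flip: has_real_derivative_iff_has_vector_derivative)
    also have "lat_deriv (2 * pi) \<theta> - lat_deriv 0 \<theta> = 0"
      by (simp add: lat_deriv_def sph_coord_def sph_\<phi>_def)
    finally show ?thesis .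
  qed
  have merid: "integral {- pi / 2..pi / 2} (merid_part \<phi>) = 0" for \<phi>
  proof -
    have "(merid_part \<phi> has_integral
        (cos (pi / 2) * merid_deriv \<phi> (pi / 2) - cos (- pi / 2) * merid_deriv \<phi> (- pi / 2))) {- pi / 2..pi / 2}"
      by (intro fundamental_theorem_of_calculus)
        (auto intro: merid_part_derivative has_field_derivative_at_within
          simp flip: has_real_derivative_iff_has_vector_derivative)
    then show ?thesis by (simp add: integral_unique)
  qed
  have int: "(\<lambda>\<phi>. merid_part \<phi> \<theta>) integrable_on {0..2 * pi}" for \<theta>
    by (intro integrable_continuous_interval
        continuous_on_compose2[OF continuous_on_merid_part[of UNIV], of _ "\<lambda>\<phi>. (\<phi>, \<theta>)", simplified])
      (intro continuous_intros)
  \<comment> \<open>Division by \<open>cos \<theta>\<close> requires the latitudes of the two poles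
    to be removed; they return below as a negligible set.\<close>
  have inner: "integral {0..2 * pi} (\<lambda>\<phi>. cos \<theta> * laplace_beltrami f (sph \<phi> \<theta>))
      = integral {0..2 * pi} (\<lambda>\<phi>. merid_part \<phi> \<theta>)" if "\<theta> \<in> {- pi / 2..pi / 2} - {- pi / 2, pi / 2}" for \<theta>
  proof -
    have c: "cos \<theta> \<noteq> 0" using that cos_gt_zero_pi[of \<theta>] by auto
    have "(\<lambda>\<phi>. cos \<theta> * laplace_beltrami f (sph \<phi> \<theta>))
        = (\<lambda>\<phi>. merid_part \<phi> \<theta> + inverse (cos \<theta>) * lat_part \<phi> \<theta>)"
      using laplace_beltrami_sph[of \<theta>] c by (auto simp: field_simps power2_eq_square)
    moreover have "((\<lambda>\<phi>. merid_part \<phi> \<theta> + inverse (cos \<theta>) * lat_part \<phi> \<theta>) has_integral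
        integral {0..2 * pi} (\<lambda>\<phi>. merid_part \<phi> \<theta>) + inverse (cos \<theta>) * 0) {0..2 * pi}"
      by (intro has_integral_add has_integral_mult_right lat integrable_integral int)
    ultimately show ?thesis by (simp add: integral_unique)
  qed
  have "integral {- pi / 2..pi / 2} (\<lambda>\<theta>. integral {0..2 * pi} (\<lambda>\<phi>. cos \<theta> * laplace_beltrami f (sph \<phi> \<theta>)))
      = integral {- pi / 2..pi / 2} (\<lambda>\<theta>. integral {0..2 * pi} (\<lambda>\<phi>. merid_part \<phi> \<theta>))"
    by (rule integral_spike[of "{- pi / 2, pi / 2}"]) (simp_all only: inner negligible_finite finite.intros)
  also have "\<dots> = integral {0..2 * pi} (\<lambda>\<phi>. integral {- pi / 2..pi / 2} (merid_part \<phi>))"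
    using integral_swap_continuous[of 0 "- pi / 2" "2 * pi" "pi / 2" merid_part] continuous_on_merid_part
    by (simp add: case_prod_unfold)
  finally show ?thesis unfolding merid by simp
qed

end

subsection \<open>Integration over the sphere and Lebesgue norms\<close>

lemma space_\<sigma> [simp]: "space \<sigma> = S2" and sets_\<sigma>: "sets \<sigma> = sets (restrict_space borel S2)"
  by (simp_all add: \<sigma>_def)

lemma measurable_sph_coord: "sph_coord \<in> borel \<rightarrow>\<^sub>M restrict_space borel S2"
proof (rule measurable_restrict_space2)
  have "continuous_on UNIV sph_coord"
    using sph_continuous(1)[of UNIV] by simp
  then show "sph_coord \<in> borel \<rightarrow>\<^sub>M borel"
    by (rule borel_measurable_continuous_onI)
  show "sph_coord \<in> space borel \<rightarrow> S2"
    using sph_in_sphere by auto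
qed

lemma sph_coord_in_sphere: "sph_coord q \<in> S2"
  using sph_in_sphere[of "fst q" "snd q"] by simp

abbreviation sph_rectangle :: "(real \<times> real) set" where
  "sph_rectangle \<equiv> cbox (0, - pi / 2) (2 * pi, pi / 2)"

lemma continuous_on_sph_integrand:
  fixes g :: "real ^ 3 \<Rightarrow> real"
  assumes "continuous_on S2 g"
  shows "continuous_on A (\<lambda>p. cos (snd p) * g (sph_coord p))"
proof -
  have "continuous_on A (\<lambda>q. g (sph_coord q))"
    using continuous_on_compose2[OF assms sph_continuous(1)[of A]] sph_coord_in_sphere
    by (simp add: image_subset_iff)
  then show ?thesis by (intro continuous_intros)
qed

text \<open>Unfolding push-forward and density turns integrals over \<open>\<sigma>\<close> into
  integrals over a compact rectangle, where Fubini for continuous functions applies.\<close>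

lemma
  fixes g :: "real ^ 3 \<Rightarrow> real"
  assumes g: "continuous_on S2 g"
  shows integrable_\<sigma>: "integrable \<sigma> g"
    and integral_\<sigma>: "(\<integral>x. g x \<partial>\<sigma>) = integral sph_rectangle (\<lambda>p. cos (snd p) * g (sph_coord p))"
proof -
  let ?w = "\<lambda>p. indicator sph_rectangle p * cos (snd p) :: real"
  let ?k = "\<lambda>p. cos (snd p) * g (sph_coord p)"
  have rect: "{0..2 * pi} \<times> {- pi / 2..pi / 2} = sph_rectangle"
    by (simp add: cbox_Pair_eq)
  have \<sigma>: "\<sigma> = distr (density lborel (\<lambda>p. ennreal (?w p))) (restrict_space borel S2) sph_coord"
    unfolding \<sigma>_def rect by (simp add: case_prod_unfold)
  have gm: "g \<in> borel_measurable (restrict_space borel S2)"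
    by (rule borel_measurable_continuous_on_restrict[OF g])
  have wm: "?w \<in> borel_measurable lborel"
    by (intro borel_measurable_times borel_measurable_indicator measurable_compose[OF _ borel_measurable_cos])
      (auto simp: measurable_lborel1 intro!: borel_measurable_continuous_onI continuous_intros)
  have w0: "AE p in lborel. 0 \<le> ?w p"
    by (intro AE_I2) (auto simp: cbox_Pair_eq cos_ge_zero indicator_def)
  have sm: "sph_coord \<in> density lborel ?w \<rightarrow>\<^sub>M restrict_space borel S2"
    using measurable_sph_coord by simp
  have gs: "(\<lambda>p. g (sph_coord p)) \<in> borel_measurable lborel"
    using measurable_compose[OF measurable_sph_coord gm] by simp
  have eq: "(\<lambda>p. ?w p *\<^sub>R g (sph_coord p)) = (\<lambda>p. indicator sph_rectangle p *\<^sub>R ?k p)"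
    by (simp add: mult.assoc)
  have int: "set_integrable lborel sph_rectangle ?k"
    unfolding set_integrable_def
    by (intro borel_integrable_compact continuous_on_sph_integrand g) simp
  have "integrable lborel (\<lambda>p. ?w p *\<^sub>R g (sph_coord p))"
    using int unfolding set_integrable_def eq .
  then have "integrable (density lborel ?w) (\<lambda>p. g (sph_coord p))"
    by (simp only: integrable_density[OF gs wm w0])
  then show "integrable \<sigma> g"
    unfolding \<sigma> integrable_distr_eq[OF sm gm] .
  have "(\<integral>x. g x \<partial>\<sigma>) = (\<integral>p. ?w p *\<^sub>R g (sph_coord p) \<partial>lborel)"
    unfolding \<sigma> integral_distr[OF sm gm] integral_density[OF gs wm w0] ..
  also have "\<dots> = (LINT p:sph_rectangle|lborel. ?k p)"
    unfolding set_lebesgue_integral_def eq ..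
  also have "\<dots> = integral sph_rectangle ?k"
    by (rule set_borel_integral_eq_integral(2)[OF int])
  finally show "(\<integral>x. g x \<partial>\<sigma>) = integral sph_rectangle ?k" .
qed

text \<open>The function \<open>g\<close> repeats the Laplacian on the sphere and carries the
  continuity: for the waves both are read off an explicit formula.\<close>

lemma zero_mean_laplace_beltrami:
  assumes "smooth_on f S2" "continuous_on S2 g" "\<And>x. x \<in> S2 \<Longrightarrow> g x = laplace_beltrami f x"
  shows "zero_mean g"
proof -
  let ?k = "\<lambda>\<phi> \<theta>. cos \<theta> * g (sph \<phi> \<theta>)"
  have cont: "continuous_on sph_rectangle (\<lambda>(\<phi>, \<theta>). ?k \<phi> \<theta>)"
    using continuous_on_sph_integrand[OF assms(2), of sph_rectangle] by (simp add: case_prod_unfold)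
  have "(\<integral>x. g x \<partial>\<sigma>) = integral sph_rectangle (\<lambda>(\<phi>, \<theta>). ?k \<phi> \<theta>)"
    unfolding integral_\<sigma>[OF assms(2)] by (simp add: case_prod_unfold)
  also have "\<dots> = integral {- pi / 2..pi / 2} (\<lambda>\<theta>. integral {0..2 * pi} (\<lambda>\<phi>. ?k \<phi> \<theta>))"
    using integral_prod_continuous[OF cont] integral_swap_continuous[OF cont] by simp
  also have "\<dots> = 0"
    using integral_laplace_beltrami_sph[OF assms(1)] assms(3) sph_in_sphere by simp
  finally show ?thesis
    using integrable_\<sigma>[OF assms(2)] by (simp add: zero_mean_def)
qed

section \<open>Lebesgue norms of continuous functions\<close>

lemma continuous_on_abs_powr:
  fixes f :: "real ^ 3 \<Rightarrow> real"
  assumes "continuous_on A f" "0 < p"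
  shows "continuous_on A (\<lambda>x. \<bar>f x\<bar> powr p)"
  using assms by (intro continuous_on_powr' continuous_intros) auto

lemma continuous_in_Lp:
  assumes "continuous_on S2 f" "0 < p"
  shows "f \<in> Lp p"
proof -
  have "f \<in> borel_measurable \<sigma>"
    using borel_measurable_continuous_on_restrict[OF assms(1)] sets_\<sigma>
    by (simp cong: measurable_cong_sets)
  then show ?thesis
    unfolding Lp_def using integrable_\<sigma>[OF continuous_on_abs_powr[OF assms]] by simp
qed

lemma Lp_norm_cong: "(\<And>x. x \<in> S2 \<Longrightarrow> f x = g x) \<Longrightarrow> Lp_norm p f = Lp_norm p g"
  unfolding Lp_norm_def by (auto intro!: arg_cong2[of _ _ _ _ "(powr)"] Bochner_Integration.integral_cong)

lemma Lp_norm_nonneg: "0 \<le> Lp_norm p f"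
  by (simp add: Lp_norm_def)

lemma Lp_norm_minus_commute: "Lp_norm p (\<lambda>x. f x - g x) = Lp_norm p (\<lambda>x. g x - f x)"
  by (simp add: Lp_norm_def abs_minus_commute)

lemma Lp_norm_zero: "Lp_norm p (\<lambda>x. 0) = 0"
  by (simp add: Lp_norm_def)

lemma Lp_norm_cmult:
  assumes "p \<noteq> 0"
  shows "Lp_norm p (\<lambda>x. c * f x) = \<bar>c\<bar> * Lp_norm p f"
  using assms by (simp add: Lp_norm_def abs_mult powr_mult powr_powr)

text \<open>Minkowski's inequality up to the factor 4, which only needs monotonicity of powers.\<close>

lemma Lp_norm_quasi_triangle:
  assumes cont: "continuous_on S2 f" "continuous_on S2 g" "continuous_on S2 k" and p: "1 \<le> p"
    and le: "Lp_norm p (\<lambda>x. f x - g x) \<le> e" "Lp_norm p (\<lambda>x. g x - k x) \<le> e"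
  shows "Lp_norm p (\<lambda>x. f x - k x) \<le> 4 * e"
proof -
  let ?N = "\<lambda>u :: real ^ 3 \<Rightarrow> real. \<integral>x. \<bar>u x\<bar> powr p \<partial>\<sigma>"
  have e: "0 \<le> e" using le(1) Lp_norm_nonneg order_trans by blast
  have int: "integrable \<sigma> (\<lambda>x. \<bar>u x - v x\<bar> powr p)"
    if "continuous_on S2 u" "continuous_on S2 v" for u v :: "real ^ 3 \<Rightarrow> real"
    using that p by (intro integrable_\<sigma> continuous_on_abs_powr continuous_intros) auto
  have N: "?N u \<le> e powr p" if "Lp_norm p u \<le> e" for u
  proof -
    have "?N u = Lp_norm p u powr p"
      using p by (simp add: Lp_norm_def powr_powr)
    also have "\<dots> \<le> e powr p"
      using that p by (intro powr_mono2) (auto simp: Lp_norm_nonneg)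
    finally show ?thesis .
  qed
  \<comment> \<open>One of the two differences is at least half of the total; this takes the place
    of convexity.\<close>
  have "\<bar>a - c\<bar> powr p \<le> 2 powr p * (\<bar>a - b\<bar> powr p + \<bar>b - c\<bar> powr p)" for a b c :: real
  proof -
    have "\<bar>a - c\<bar> powr p \<le> (2 * max \<bar>a - b\<bar> \<bar>b - c\<bar>) powr p"
      using p by (intro powr_mono2) (auto simp: max_def abs_if)
    also have "\<dots> = 2 powr p * max \<bar>a - b\<bar> \<bar>b - c\<bar> powr p"
      by (simp add: powr_mult)
    also have "\<dots> \<le> 2 powr p * (\<bar>a - b\<bar> powr p + \<bar>b - c\<bar> powr p)"
      by (intro mult_left_mono) (auto simp: max_def)
    finally show ?thesis .
  qed
  then have "?N (\<lambda>x. f x - k x) \<le>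
      (\<integral>x. 2 powr p * (\<bar>f x - g x\<bar> powr p + \<bar>g x - k x\<bar> powr p) \<partial>\<sigma>)"
    by (intro integral_mono int cont Bochner_Integration.integrable_add integrable_mult_right) auto
  also have "\<dots> = 2 powr p * (?N (\<lambda>x. f x - g x) + ?N (\<lambda>x. g x - k x))"
    by (simp add: int cont)
  also have "\<dots> \<le> 2 powr p * (e powr p + e powr p)"
    using N le by (intro mult_left_mono add_mono) auto
  \<comment> \<open>Since \<open>1 \<le> p\<close>, the two equal summands are absorbed by
    \<open>2 \<le> 2 powr p\<close>; the factor \<open>4 powr p\<close> then leaves the norm as
    4.\<close>
  also have "\<dots> \<le> 2 powr p * (2 powr p * e powr p)"
    using p powr_mono[of 1 p 2] by (intro mult_left_mono) (auto simp: mult_right_mono)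
  also have "\<dots> = (4 * e) powr p"
    using e powr_mult[of 2 2 p] by (simp add: powr_mult)
  finally have "Lp_norm p (\<lambda>x. f x - k x) \<le> ((4 * e) powr p) powr (1 / p)"
    unfolding Lp_norm_def using p by (intro powr_mono2) auto
  then show ?thesis using e p by (simp add: powr_powr)
qed

text \<open>The poles are excluded so that \<open>cos \<theta>\<close> is nonzero and can be
  cancelled from the area density.\<close>

lemma sph_coord_surj:
  assumes "x \<in> S2" "\<bar>x $ 3\<bar> < 1"
  obtains \<phi> \<theta> where "(\<phi>, \<theta>) \<in> sph_rectangle" "cos \<theta> \<noteq> 0" "x = sph \<phi> \<theta>"
proof -
  define \<theta> where "\<theta> = arcsin (x $ 3)"
  have \<theta>: "- (pi / 2) < \<theta>" "\<theta> < pi / 2" "sin \<theta> = x $ 3"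
    using arcsin_lt_bounded[of "x $ 3"] assms(2) by (auto simp: \<theta>_def)
  have c: "cos \<theta> > 0" using cos_gt_zero_pi \<theta> by auto
  have "(x $ 1)\<^sup>2 + (x $ 2)\<^sup>2 + (x $ 3)\<^sup>2 = 1"
    using assms(1) by (simp add: norm_vec_def L2_set_def sum_3)
  then have "(x $ 1)\<^sup>2 + (x $ 2)\<^sup>2 = (cos \<theta>)\<^sup>2"
    using sin_cos_squared_add[of \<theta>] \<theta>(3) by simp
  then have "(x $ 1 / cos \<theta>)\<^sup>2 + (x $ 2 / cos \<theta>)\<^sup>2 = 1"
    using c by (simp add: power_divide flip: add_divide_distrib)
  then obtain \<phi> where \<phi>: "0 \<le> \<phi>" "\<phi> < 2 * pi" "x $ 1 / cos \<theta> = cos \<phi>" "x $ 2 / cos \<theta> = sin \<phi>"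
    using sincos_total_2pi by blast
  show ?thesis
  proof
    show "(\<phi>, \<theta>) \<in> sph_rectangle" using \<phi> \<theta> by (simp add: cbox_Pair_eq)
    show "cos \<theta> \<noteq> 0" using c by simp
    have "x $ 1 = cos \<theta> * cos \<phi>" "x $ 2 = cos \<theta> * sin \<phi>"
      using c \<phi>(3,4) by (simp_all add: field_simps)
    then show "x = sph \<phi> \<theta>"
      using \<theta>(3) by (simp add: sph_coord_def vec_eq_iff forall_3)
  qed
qed

text \<open>The integrand including its density is continuous and nonnegative on the rectangle, so a
  zero integral makes it vanish pointwise. At the poles the density itself is 0 and nothing is
  learned.\<close>

lemma Lp_norm_eq_0_imp:
  assumes "continuous_on S2 f" "0 < p" "Lp_norm p f = 0" "x \<in> S2" "\<bar>x $ 3\<bar> < 1"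
  shows "f x = 0"
proof -
  let ?k = "\<lambda>q. cos (snd q) * \<bar>f (sph_coord q)\<bar> powr p"
  obtain \<phi> \<theta> where x: "(\<phi>, \<theta>) \<in> sph_rectangle" "cos \<theta> \<noteq> 0" "x = sph \<phi> \<theta>"
    using sph_coord_surj assms(4,5) by blast
  note c = continuous_on_abs_powr[OF assms(1,2)]
  have I: "integral sph_rectangle ?k = 0"
    using assms(3) by (simp add: Lp_norm_def integral_\<sigma>[OF c])
  have "(?k has_integral integral sph_rectangle ?k) sph_rectangle"
    by (intro integrable_integral integrable_continuous continuous_on_sph_integrand c)
  then have int: "(?k has_integral 0) sph_rectangle"
    unfolding I .
  have nonneg: "0 \<le> ?k q" if "q \<in> box (0, - pi / 2) (2 * pi, pi / 2)" for q
    using that box_subset_cbox[of "(0, - pi / 2)" "(2 * pi, pi / 2)"]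
    by (auto simp: cbox_Pair_eq intro!: mult_nonneg_nonneg cos_ge_zero)
  have "(pi, 0) \<in> box (0, - pi / 2) (2 * pi, pi / 2)"
    by (auto simp: mem_box Basis_prod_def)
  then have ne: "box (0, - pi / 2) (2 * pi, pi / 2) \<noteq> {}"
    by blast
  have "?k (\<phi>, \<theta>) = 0"
    by (rule has_integral_0_cbox_imp_0[OF continuous_on_sph_integrand[OF c] nonneg int ne x(1)])
  then show ?thesis using x by simp
qed

subsection \<open>Height function and rotations\<close>

lemma smooth_on_sphere_continuous:
  assumes "smooth_on f S2"
  shows "continuous_on S2 f"
proof -
  have "continuous_on (- {0}) (\<lambda>y. f (sgn y))"
    using assms Ck_on_continuous unfolding smooth_on_sphere_iff by blast
  then have "continuous_on S2 (\<lambda>y. f (sgn y))"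
    by (rule continuous_on_subset) auto
  then show ?thesis
    by (rule continuous_on_eq) (simp add: sgn_sphere)
qed

lemma smooth_on_sphere_lincomb:
  assumes "smooth_on f S2" "smooth_on g S2"
  shows "smooth_on (\<lambda>x. a * f x + b * g x) S2"
  unfolding smooth_on_sphere_iff
proof
  fix k
  have "Ck_on k (\<lambda>y. f (sgn y)) (- {0})" "Ck_on k (\<lambda>y. g (sgn y)) (- {0})"
    using assms unfolding smooth_on_sphere_iff by auto
  then show "Ck_on k (\<lambda>y. a * f (sgn y) + b * g (sgn y)) (- {0})"
    by (intro Ck_on_add Ck_on_mult Ck_on_const open_nonzero)
qed

lemma
  fixes h k :: "'a::euclidean_space \<Rightarrow> real"
  assumes U: "open U" "Ck_on 2 h U" "Ck_on 2 k U" and x: "x \<in> U"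
  shows frechet_derivative_lincomb: "frechet_derivative (\<lambda>y. a * h y + b * k y) (at x) u =
      a * frechet_derivative h (at x) u + b * frechet_derivative k (at x) u"
    and hess_lincomb: "hess (\<lambda>y. a * h y + b * k y) x u v = a * hess h x u v + b * hess k x u v"
proof -
  have D: "frechet_derivative (\<lambda>y. a * h y + b * k y) (at x) =
      (\<lambda>u. a * frechet_derivative h (at x) u + b * frechet_derivative k (at x) u)" if "x \<in> U" for x
    by (rule frechet_derivative_at[symmetric])
      (intro has_derivative_add has_derivative_mult_right C2_has_derivative[OF U(1)] U that)
  then show "frechet_derivative (\<lambda>y. a * h y + b * k y) (at x) u =
      a * frechet_derivative h (at x) u + b * frechet_derivative k (at x) u"
    using x by simp
  have "hess (\<lambda>y. a * h y + b * k y) x u =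
      frechet_derivative (\<lambda>y. a * frechet_derivative h (at y) u + b * frechet_derivative k (at y) u) (at x)"
    unfolding hess_def by (rule frechet_derivative_cong_open[OF U(1) x]) (simp add: D)
  also have "\<dots> = (\<lambda>v. a * hess h x u v + b * hess k x u v)"
    by (rule frechet_derivative_at[symmetric])
      (intro has_derivative_add has_derivative_mult_right C2_has_derivative2[OF U(1)] U x)
  finally show "hess (\<lambda>y. a * h y + b * k y) x u v = a * hess h x u v + b * hess k x u v"
    by simp
qed

lemma
  assumes f: "smooth_on f S2" and g: "smooth_on g S2" and x: "x \<in> S2"
  shows grad_lincomb: "grad (\<lambda>x. a * f x + b * g x) x = a *\<^sub>R grad f x + b *\<^sub>R grad g x"
    and laplace_beltrami_lincomb: "laplace_beltrami (\<lambda>x. a * f x + b * g x) x =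
      a * laplace_beltrami f x + b * laplace_beltrami g x"
proof -
  have x': "x \<in> - {0}" using x by auto
  show "grad (\<lambda>x. a * f x + b * g x) x = a *\<^sub>R grad f x + b *\<^sub>R grad g x"
    unfolding grad_def sph_diff_def
    by (simp add: frechet_derivative_lincomb[OF open_nonzero C2_radial[OF f] C2_radial[OF g] x']
        scaleR_add_left sum.distrib scaleR_sum_right)
  show "laplace_beltrami (\<lambda>x. a * f x + b * g x) x =
      a * laplace_beltrami f x + b * laplace_beltrami g x"
    unfolding laplace_beltrami_eq[OF smooth_on_sphere_lincomb[OF f g] x]
      laplace_beltrami_eq[OF f x] laplace_beltrami_eq[OF g x]
    by (simp add: hess_lincomb[OF open_nonzero C2_radial[OF f] C2_radial[OF g] x']
        sum.distrib sum_distrib_left)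
qed

lemma smooth_on_height: "smooth_on (\<lambda>x. x $ 3) S2"
  unfolding smooth_on_def
  by (rule exI[of _ UNIV], rule exI[of _ "\<lambda>x. x $ 3"])
    (auto intro: Ck_on_linear bounded_linear_vec_nth)

lemma grad_height:
  assumes "x \<in> S2"
  shows "grad (\<lambda>x. x $ 3) x = axis 3 1 - x $ 3 *\<^sub>R x"
proof -
  have "norm x = 1" using assms by simp
  from bounded_linear.has_derivative[OF bounded_linear_vec_nth sgn_has_derivative[OF this], of 3]
  have "frechet_derivative (\<lambda>y. sgn y $ 3) (at x) = (\<lambda>v. (v - (x \<bullet> v) *\<^sub>R x) $ 3)"
    by (rule frechet_derivative_at[symmetric])
  then show ?thesis
    by (simp add: grad_def sph_diff_def sum_Basis_3 vec_eq_iff forall_3 inner_axis)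
      (simp_all add: axis_def)
qed

text \<open>The gradient is the third unit vector minus \<open>x $ 3\<close> times the position. Up
  to normal terms its derivative is \<open>- x $ 3\<close> times the tangential projection, whose
  trace 3 - 1 = 2 is the eigenvalue.\<close>

lemma laplace_beltrami_height:
  assumes x: "x \<in> S2"
  shows "laplace_beltrami (\<lambda>x. x $ 3) x = - 2 * x $ 3"
proof -
  let ?P = "\<lambda>v. v - (x \<bullet> v) *\<^sub>R x"
  have n: "norm x = 1" "x \<bullet> x = 1" "x \<in> - {0}" using x by (auto simp: norm_eq_sqrt_inner)
  note P = sgn_has_derivative[OF n(1)]
  have sx: "sgn x = x" using x by (rule sgn_sphere)
  have "((\<lambda>y. axis 3 1 - sgn y $ 3 *\<^sub>R sgn y) has_derivative
      (\<lambda>v. 0 - (sgn x $ 3 *\<^sub>R ?P v + ?P v $ 3 *\<^sub>R sgn x))) (at x)"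
    by (intro has_derivative_diff has_derivative_const has_derivative_scaleR P
        bounded_linear.has_derivative[OF bounded_linear_vec_nth P])
  then have "((\<lambda>y. grad (\<lambda>x. x $ 3) (sgn y)) has_derivative
      (\<lambda>v. 0 - (sgn x $ 3 *\<^sub>R ?P v + ?P v $ 3 *\<^sub>R sgn x))) (at x)"
    by (rule has_derivative_transform_within_open[OF _ open_nonzero n(3)])
      (simp add: grad_height norm_sgn)
  then have d: "sph_diff (grad (\<lambda>x. x $ 3)) x v = - (x $ 3 *\<^sub>R ?P v + ?P v $ 3 *\<^sub>R x)" for v
    unfolding sph_diff_def sx by (simp add: frechet_derivative_at[symmetric])
  have "x \<bullet> ?P v = 0" for v
    by (simp add: inner_diff_right n)
  then have cov: "cov_deriv (grad (\<lambda>x. x $ 3)) x v = - (x $ 3 *\<^sub>R ?P v)" for v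
    unfolding cov_deriv_def d by (simp only: inner_minus_right inner_add_right inner_scaleR_right n)
      (simp add: algebra_simps)
  have "(\<Sum>e\<in>Basis. ?P e \<bullet> e) = 3 - (\<Sum>e\<in>Basis. (x \<bullet> e) * (x \<bullet> e))"
    by (simp add: inner_diff_left sum_subtractf)
  also have "\<dots> = 2"
    by (simp add: n(2) flip: euclidean_inner)
  finally have "(\<Sum>e\<in>Basis. x $ 3 * (?P e \<bullet> e)) = x $ 3 * 2"
    by (simp only: flip: sum_distrib_left)
  then show ?thesis
    unfolding laplace_beltrami_def sph_div_def cov
    by (simp only: inner_minus_left inner_scaleR_left sum_negf)
qed

section \<open>Rotations about the third axis and functions composed with them\<close>

lemma rot3_component [simp]: "rot3 \<beta> x $ 3 = x $ 3"
  by (simp add: rot3_def)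

lemma rot3_periodic: "rot3 (\<beta> + 2 * pi * of_int k) x = rot3 \<beta> x"
  by (simp add: rot3_def sin_add cos_add cos_int_2pin sin_int_2pin)

lemma orthogonal_transformation_rot3: "orthogonal_transformation (rot3 \<beta>)"
  unfolding orthogonal_transformation_def
proof (intro conjI allI)
  show "linear (rot3 \<beta>)"
    by (rule linearI) (simp_all add: rot3_def vec_eq_iff forall_3 algebra_simps)
  fix x y :: "real ^ 3"
  have "cos \<beta> * cos \<beta> + sin \<beta> * sin \<beta> = 1"
    by (simp flip: power2_eq_square)
  then have "(cos \<beta> * x $ 1 - sin \<beta> * x $ 2) * (cos \<beta> * y $ 1 - sin \<beta> * y $ 2)
    + (sin \<beta> * x $ 1 + cos \<beta> * x $ 2) * (sin \<beta> * y $ 1 + cos \<beta> * y $ 2) = x $ 1 * y $ 1 + x $ 2 * y $ 2"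
    by algebra
  then show "rot3 \<beta> x \<bullet> rot3 \<beta> y = x \<bullet> y"
    by (simp add: rot3_def inner_vec_def sum_3)
qed

lemma linear_rot3: "linear (rot3 \<beta>)"
  by (rule orthogonal_transformation_linear[OF orthogonal_transformation_rot3])

lemma norm_rot3 [simp]: "norm (rot3 \<beta> x) = norm x"
  using orthogonal_transformation_norm[OF orthogonal_transformation_rot3] .

lemma rot3_in_sphere: "x \<in> S2 \<Longrightarrow> rot3 \<beta> x \<in> S2"
  by simp

lemma rot3_nonzero: "x \<noteq> 0 \<Longrightarrow> rot3 \<beta> x \<noteq> 0"
  using norm_rot3[of \<beta> x] by (metis norm_eq_zero)

lemma rot3_sgn: "rot3 \<beta> (sgn y) = sgn (rot3 \<beta> y)"
  by (simp add: sgn_div_norm linear_cmul[OF linear_rot3])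

lemma rot3_has_derivative: "(rot3 \<beta> has_derivative rot3 \<beta>) (at x)"
  by (intro bounded_linear_imp_has_derivative linear_conv_bounded_linear[THEN iffD1] linear_rot3)

lemma rot3_has_vector_derivative:
  "((\<lambda>s. rot3 s x) has_vector_derivative cross3 (axis 3 1) (rot3 s x)) (at s)"
proof -
  have "((\<lambda>s. rot3 s x) has_vector_derivative
      vector [- sin s * x $ 1 - cos s * x $ 2, cos s * x $ 1 - sin s * x $ 2, 0]) (at s)"
    unfolding rot3_def by (intro has_vector_derivative_vector_3) (auto intro!: derivative_eq_intros)
  also have "vector [- sin s * x $ 1 - cos s * x $ 2, cos s * x $ 1 - sin s * x $ 2, 0]
      = cross3 (axis 3 1) (rot3 s x)"
    by (simp add: cross3_def rot3_def axis_def vec_eq_iff forall_3)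
  finally show ?thesis .
qed

text \<open>A rotation commutes with its generator. This moves the velocity of a rotating point back
  to the fixed point \<open>x\<close>.\<close>

lemma rot3_cross3_axis: "rot3 \<beta> (cross3 (axis 3 1) x) = cross3 (axis 3 1) (rot3 \<beta> x)"
  by (simp add: cross3_def rot3_def axis_def vec_eq_iff forall_3)

context
  fixes f :: "real ^ 3 \<Rightarrow> real"
  assumes f: "smooth_on f S2"
begin

lemma smooth_on_rot3: "smooth_on (\<lambda>x. f (rot3 \<beta> x)) S2"
  unfolding smooth_on_sphere_iff rot3_sgn
proof
  fix k
  have lin: "Ck_on k (\<lambda>x. rot3 \<beta> x \<bullet> e) (- {0})" for e
    using linear_compose[OF linear_rot3, of "\<lambda>y. y \<bullet> e"]
    by (intro Ck_on_linear open_nonzero linear_conv_bounded_linear[THEN iffD1])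
      (simp add: o_def bounded_linear.linear bounded_linear_inner_left)
  have "Ck_on k (\<lambda>y. f (sgn y)) (- {0})"
    using f unfolding smooth_on_sphere_iff by blast
  then show "Ck_on k (\<lambda>y. f (sgn (rot3 \<beta> y))) (- {0})"
    by (intro Ck_on_compose[where \<phi> = "rot3 \<beta>" and V = "- {0}", OF open_nonzero _ lin])
      (simp_all add: rot3_nonzero)
qed

lemma radial_derivative_rot3:
  assumes "x \<noteq> 0"
  shows "frechet_derivative (\<lambda>y. f (rot3 \<beta> (sgn y))) (at x) =
    (\<lambda>v. frechet_derivative (\<lambda>y. f (sgn y)) (at (rot3 \<beta> x)) (rot3 \<beta> v))"
proof -
  have "((\<lambda>y. f (sgn y)) has_derivative frechet_derivative (\<lambda>y. f (sgn y)) (at (rot3 \<beta> x))) (at (rot3 \<beta> x))"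
    using C2_has_derivative[OF open_nonzero C2_radial[OF f]] rot3_nonzero[OF assms] by simp
  from has_derivative_compose[OF rot3_has_derivative this]
  show ?thesis unfolding rot3_sgn by (rule frechet_derivative_at[symmetric])
qed

text \<open>The second derivative of the rotated function is that of \<open>f\<close> with both
  arguments rotated, so the sum over the standard basis becomes the trace in the rotated
  frame.\<close>

lemma laplace_beltrami_rot3:
  assumes x: "x \<in> S2"
  shows "laplace_beltrami (\<lambda>x. f (rot3 \<beta> x)) x = laplace_beltrami f (rot3 \<beta> x)"
proof -
  let ?h = "\<lambda>y. f (sgn y)"
  have x0: "x \<in> - {0}" using x by auto
  have "hess (\<lambda>y. f (rot3 \<beta> (sgn y))) x u = (\<lambda>v. hess ?h (rot3 \<beta> x) (rot3 \<beta> u) (rot3 \<beta> v))" for u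
  proof -
    have "hess (\<lambda>y. f (rot3 \<beta> (sgn y))) x u =
        frechet_derivative (\<lambda>y. frechet_derivative ?h (at (rot3 \<beta> y)) (rot3 \<beta> u)) (at x)"
      unfolding hess_def
      by (rule frechet_derivative_cong_open[OF open_nonzero x0]) (simp add: radial_derivative_rot3)
    also have "\<dots> = (\<lambda>v. hess ?h (rot3 \<beta> x) (rot3 \<beta> u) (rot3 \<beta> v))"
      using has_derivative_compose[OF rot3_has_derivative
          C2_has_derivative2[OF open_nonzero C2_radial[OF f]]] x0 rot3_nonzero
      by (intro frechet_derivative_at[symmetric]) auto
    finally show ?thesis .
  qed
  then show ?thesis
    unfolding laplace_beltrami_eq[OF smooth_on_rot3 x]
      laplace_beltrami_orthogonal[OF f orthogonal_transformation_rot3 rot3_in_sphere[OF x], of \<beta> \<beta>]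
    by simp
qed

lemma inner_grad_rot3:
  assumes "x \<in> S2"
  shows "grad (\<lambda>x. f (rot3 \<beta> x)) x \<bullet> v = grad f (rot3 \<beta> x) \<bullet> rot3 \<beta> v"
proof -
  have "x \<noteq> 0" using assms by auto
  then show ?thesis
    using inner_grad[OF smooth_on_rot3[of \<beta>], of x v] inner_grad[OF f, of "rot3 \<beta> x"] rot3_nonzero
    by (simp add: radial_derivative_rot3)
qed

text \<open>Brings the time derivative of a rotating function into the form of the right side of
  \<open>wave_advection\<close>, a gradient at \<open>x\<close> paired with the rotation field, so
  that the two terms of the vorticity equation can be compared.\<close>

lemma rot3_orbit_derivative:
  assumes "x \<in> S2"
  shows "((\<lambda>s. f (rot3 s x)) has_real_derivative grad (\<lambda>x. f (rot3 s x)) x \<bullet> cross3 (axis 3 1) x) (at s)"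
proof -
  have x: "x \<noteq> 0" using assms by auto
  have "((\<lambda>s. f (sgn (rot3 s x))) has_real_derivative
      frechet_derivative (\<lambda>y. f (sgn y)) (at (rot3 s x)) (cross3 (axis 3 1) (rot3 s x))) (at s)"
    using C2_curve[OF open_nonzero C2_radial[OF f] rot3_has_vector_derivative] rot3_nonzero[OF x] by simp
  also have "frechet_derivative (\<lambda>y. f (sgn y)) (at (rot3 s x)) (cross3 (axis 3 1) (rot3 s x))
      = grad (\<lambda>x. f (rot3 s x)) x \<bullet> cross3 (axis 3 1) x"
    unfolding inner_grad_rot3[OF assms] rot3_cross3_axis using inner_grad[OF f rot3_nonzero[OF x]] by simp
  finally show ?thesis
    using assms by (simp add: sgn_sphere)
qed

text \<open>The extension demanded by \<open>smooth_on\<close> is constant along rays in the second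
  summand and defined for all real times, so smoothness up to time 0 comes for free.\<close>

lemma smooth_on_rot3_time:
  "smooth_on (\<lambda>(x, t). a * x $ 3 + f (rot3 (\<beta> + c * t) x)) (S2 \<times> {0..})"
proof -
  let ?U = "(- {0 :: real ^ 3}) \<times> (UNIV :: real set)"
  let ?\<phi> = "\<lambda>p. rot3 (\<beta> + c * snd p) (fst p)"
  have U: "open ?U" by (intro open_Times open_nonzero open_UNIV)
  have "Ck_on k (\<lambda>p. a * fst p $ 3 + f (sgn (?\<phi> p))) ?U" for k
  proof -
    have lin: "Ck_on k (\<lambda>p. fst p $ i) ?U" for i
      by (intro Ck_on_linear U bounded_linear_compose[OF bounded_linear_vec_nth bounded_linear_fst])
    have "Ck_on k (\<lambda>p. \<beta> + c * snd p) ?U"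
      by (intro Ck_on_add Ck_on_mult Ck_on_const Ck_on_linear U bounded_linear_snd)
    then have trig: "Ck_on k (\<lambda>p. cos (\<beta> + c * snd p)) ?U" "Ck_on k (\<lambda>p. sin (\<beta> + c * snd p)) ?U"
      using Ck_on_compose_real[OF U _ _ Ck_on_sin_cos[THEN conjunct1]]
        Ck_on_compose_real[OF U _ _ Ck_on_sin_cos[THEN conjunct2]] by auto
    \<comment> \<open>The minus sign is written as a factor so that closure under sums and products
      suffices.\<close>
    have 1: "Ck_on k (\<lambda>p. cos (\<beta> + c * snd p) * fst p $ 1 + (- 1) * (sin (\<beta> + c * snd p) * fst p $ 2)) ?U"
      "Ck_on k (\<lambda>p. sin (\<beta> + c * snd p) * fst p $ 1 + cos (\<beta> + c * snd p) * fst p $ 2) ?U"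
      by (intro Ck_on_add Ck_on_mult Ck_on_const U trig lin)+
    have "Ck_on k (\<lambda>p. ?\<phi> p $ i) ?U" for i
      using exhaust_3[of i] 1 lin[of 3] by (auto simp: rot3_def)
    then have comp: "Ck_on k (\<lambda>p. ?\<phi> p \<bullet> e) ?U" if "e \<in> Basis" for e
      using that by (auto simp: Basis_vec_def inner_axis)
    have fk: "Ck_on k (\<lambda>y. f (sgn y)) (- {0})"
      using f unfolding smooth_on_sphere_iff by blast
    have "Ck_on k (\<lambda>p. f (sgn (?\<phi> p))) ?U"
      by (rule Ck_on_compose[where \<phi> = ?\<phi>, OF U _ comp fk]) (auto dest: rot3_nonzero)
    then show ?thesis by (intro Ck_on_add Ck_on_mult Ck_on_const U lin)
  qed
  moreover have "\<forall>p\<in>S2 \<times> {0..}. a * fst p $ 3 + f (sgn (?\<phi> p)) =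
      (case p of (x, t) \<Rightarrow> a * x $ 3 + f (rot3 (\<beta> + c * t) x))"
    by (auto simp: sgn_sphere)
  moreover have "S2 \<times> {0..} \<subseteq> ?U" by auto
  ultimately show ?thesis
    unfolding smooth_on_def using U
    by (intro exI[of _ ?U] exI[of _ "\<lambda>p. a * fst p $ 3 + f (sgn (?\<phi> p))"] conjI allI)
qed

end

subsection \<open>Rossby-Haurwitz waves and stability\<close>

text \<open>A classical solution represents itself by a constant Cauchy sequence; the exponent 2 is
  the witness for \<open>r\<close>.\<close>

lemma is_\<G>_classical:
  assumes g: "smooth_on g S2" and f: "continuous_on S2 f"
    and eq: "\<And>x. x \<in> S2 \<Longrightarrow> laplace_beltrami g x = - f x"
    and mean: "zero_mean f" "zero_mean g"
  shows "is_\<G> f g"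
proof -
  have grad0: "grad (\<lambda>x. 0) = (\<lambda>x. 0)"
    by (simp add: grad_def sph_diff_def fun_eq_iff)
  have "cov_deriv (\<lambda>x. 0) x v = 0" for x v
    by (simp add: cov_deriv_def sph_diff_def)
  then have W0: "W2_norm 2 (\<lambda>x. 0) = 0"
    by (simp add: W2_norm_def hess_norm_def grad0)
  have approx: "W2_approx 2 (\<lambda>n. g) g"
    using g continuous_in_Lp[OF smooth_on_sphere_continuous[OF g], of 2]
    by (simp add: W2_approx_def W0 Lp_norm_zero)
  have "Lp_norm 2 (\<lambda>x. laplace_beltrami g x - - f x) = Lp_norm 2 (\<lambda>x. 0)"
    by (rule Lp_norm_cong) (simp add: eq)
  then have lim: "(\<lambda>n::nat. Lp_norm 2 (\<lambda>x. laplace_beltrami g x - - f x)) \<longlonglongrightarrow> 0"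
    by (simp only: Lp_norm_zero tendsto_const)
  have "(\<lambda>x. - f x) \<in> Lp 2"
    by (intro continuous_in_Lp continuous_on_minus f) simp
  then have "W2_laplacian 2 g (\<lambda>x. - f x)"
    unfolding W2_laplacian_def
    using approx lim by (intro conjI exI[of _ "\<lambda>n. g"])
  moreover have "f \<in> Lp 2"
    by (intro continuous_in_Lp f) simp
  moreover have "g \<in> W2 2"
    unfolding W2_def using approx by blast
  ultimately have "f \<in> Lp 2 \<and> zero_mean f \<and> g \<in> W2 2 \<and> zero_mean g \<and> W2_laplacian 2 g (\<lambda>x. - f x)"
    using mean by simp
  then show ?thesis
    unfolding is_\<G>_def by (intro exI[of _ 2]) simp
qed

section \<open>Superpositions of the height function and an eigenfunction of degree two\<close>

context
  fixes Z :: "real ^ 3 \<Rightarrow> real"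
  assumes Z: "smooth_on Z S2" and eigen: "\<And>x. x \<in> S2 \<Longrightarrow> laplace_beltrami Z x = - 6 * Z x"
begin

lemma smooth_on_wave: "smooth_on (\<lambda>x. a * x $ 3 + b * Z x) S2"
  by (rule smooth_on_sphere_lincomb[OF smooth_on_height Z])

lemma laplace_beltrami_wave:
  "x \<in> S2 \<Longrightarrow> laplace_beltrami (\<lambda>x. a * x $ 3 + b * Z x) x = - 2 * a * x $ 3 - 6 * b * Z x"
  using laplace_beltrami_lincomb[OF smooth_on_height Z] laplace_beltrami_height eigen by simp

text \<open>The wave is the Laplacian of the wave whose coefficients are divided by the eigenvalues
  -2 and -6.\<close>

lemma zero_mean_wave: "zero_mean (\<lambda>x. a * x $ 3 + b * Z x)"
proof (rule zero_mean_laplace_beltrami[OF smooth_on_wave[of "- a / 2" "- b / 6"]])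
  show "continuous_on S2 (\<lambda>x. a * x $ 3 + b * Z x)"
    by (rule smooth_on_sphere_continuous[OF smooth_on_wave])
  show "a * x $ 3 + b * Z x = laplace_beltrami (\<lambda>x. - a / 2 * x $ 3 + - b / 6 * Z x) x" if "x \<in> S2" for x
    unfolding laplace_beltrami_wave[OF that] by simp
qed

lemma is_\<G>_wave: "is_\<G> (\<lambda>x. a * x $ 3 + b * Z x) (\<lambda>x. (a / 2) * x $ 3 + (b / 6) * Z x)"
proof (rule is_\<G>_classical[OF smooth_on_wave _ _ zero_mean_wave zero_mean_wave])
  show "continuous_on S2 (\<lambda>x. a * x $ 3 + b * Z x)"
    by (rule smooth_on_sphere_continuous[OF smooth_on_wave])
  show "laplace_beltrami (\<lambda>x. a / 2 * x $ 3 + b / 6 * Z x) x = - (a * x $ 3 + b * Z x)" if "x \<in> S2" for x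
    unfolding laplace_beltrami_wave[OF that] by simp
qed

text \<open>The form \<open>J x u \<bullet> v\<close> is alternating in \<open>u\<close> and
  \<open>v\<close>, so only a determinant of the coefficients survives, times the derivative of
  \<open>Z\<close> along the rotation field.\<close>

lemma wave_advection:
  assumes x: "x \<in> S2"
  shows "J x (grad (\<lambda>x. a * x $ 3 + b * Z x) x) \<bullet> grad (\<lambda>x. c * x $ 3 + d * Z x) x =
    (b * c - a * d) * (grad Z x \<bullet> cross3 (axis 3 1) x)"
proof -
  have "cross3 x (axis 3 1 - x $ 3 *\<^sub>R x) = - cross3 (axis 3 1) x"
    by (simp add: cross3_def axis_def vec_eq_iff forall_3 algebra_simps)
  then have G: "cross3 x (grad (\<lambda>x. x $ 3) x) \<bullet> w = - (w \<bullet> cross3 (axis 3 1) x)" for w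
    by (simp add: grad_height[OF x] inner_commute)
  have skew: "cross3 x u \<bullet> v = - (cross3 x v \<bullet> u)" for u v
    by (simp add: cross3_def inner_vec_def sum_3 algebra_simps)
  have zero: "cross3 x u \<bullet> u = 0" for u
    by (simp add: dot_cross_self)
  have Z': "cross3 x (grad Z x) \<bullet> grad (\<lambda>x. x $ 3) x = grad Z x \<bullet> cross3 (axis 3 1) x"
    by (subst skew) (simp only: G minus_minus)
  have "cross3 x (a *\<^sub>R u + b *\<^sub>R v) \<bullet> (c *\<^sub>R u + d *\<^sub>R v) =
      a * d * (cross3 x u \<bullet> v) + b * c * (cross3 x v \<bullet> u)" for u v
    by (simp add: cross_add_right cross_mult_right inner_add_left inner_add_right zero)
  then show ?thesis
    unfolding J_def grad_lincomb[OF smooth_on_height Z x] by (simp add: G Z' left_diff_distrib)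
qed

end

text \<open>Rossby-Haurwitz waves: the zonal part makes the second-degree part rotate rigidly.\<close>

lemma rossby_haurwitz_solution:
  assumes Y: "Y \<in> E2"
  shows "smooth_solution \<omega> (\<lambda>t x. a * x $ 3 + Y (rot3 (\<beta> + (\<omega> - a / 3) * t) x))"
proof -
  let ?c = "\<omega> - a / 3"
  let ?Z = "\<lambda>t x. Y (rot3 (\<beta> + ?c * t) x)"
  let ?\<psi> = "\<lambda>t x. (a / 2) * x $ 3 + (1 / 6) * ?Z t x"
  have smooth: "smooth_on Y S2" using Y by (simp add: E2_def)
  have eigen: "laplace_beltrami Y x = - 6 * Y x" if "x \<in> S2" for x
  proof -
    have "- laplace_beltrami Y x = 6 * Y x" using Y that unfolding E2_def by blast
    then show ?thesis by linarith
  qed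
  have Z: "smooth_on (?Z t) S2" for t
    by (rule smooth_on_rot3[OF smooth])
  have eigenZ: "laplace_beltrami (?Z t) x = - 6 * ?Z t x" if "x \<in> S2" for t x
    unfolding laplace_beltrami_rot3[OF smooth that] by (rule eigen[OF rot3_in_sphere[OF that]])
  have eqn: "deriv (\<lambda>s. a * x $ 3 + ?Z s x) t
      + J x (grad (\<lambda>y. \<omega> * y $ 3 - ?\<psi> t y) x) \<bullet> grad (\<lambda>x. a * x $ 3 + ?Z t x) x = 0"
    if x: "x \<in> S2" for x t
  proof -
    let ?D = "grad (?Z t) x \<bullet> cross3 (axis 3 1) x"
    have "((\<lambda>s. \<beta> + ?c * s) has_real_derivative ?c) (at t)"
      by (auto intro!: derivative_eq_intros)
    from DERIV_chain2[OF rot3_orbit_derivative[OF smooth x] this]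
    have "((\<lambda>s. ?Z s x) has_real_derivative ?D * ?c) (at t)" .
    from DERIV_imp_deriv[OF DERIV_add[OF DERIV_const this]]
    have 1: "deriv (\<lambda>s. a * x $ 3 + ?Z s x) t = ?D * ?c"
      by (simp only: add_0)
    have 2: "(\<lambda>y. \<omega> * y $ 3 - ?\<psi> t y) = (\<lambda>y. (\<omega> - a / 2) * y $ 3 + (- 1 / 6) * ?Z t y)"
      by (rule ext) (simp add: left_diff_distrib)
    \<comment> \<open>The stream function has coefficient \<open>\<omega> - a / 2\<close> on the
      height and \<open>- 1 / 6\<close> on \<open>?Z\<close>, so the factor of \<open>?D\<close> is
      \<open>a / 3 - \<omega>\<close>, that is \<open>- ?c\<close>.\<close>
    have "J x (grad (\<lambda>y. (\<omega> - a / 2) * y $ 3 + (- 1 / 6) * ?Z t y) x) \<bullet> grad (\<lambda>x. a * x $ 3 + 1 * ?Z t x) x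
        = (- 1 / 6 * a - (\<omega> - a / 2) * 1) * ?D"
      by (rule wave_advection[OF Z[of t] eigenZ[of _ t] x])
    then have 3: "J x (grad (\<lambda>y. (\<omega> - a / 2) * y $ 3 + (- 1 / 6) * ?Z t y) x) \<bullet> grad (\<lambda>x. a * x $ 3 + ?Z t x) x
        = (- 1 / 6 * a - (\<omega> - a / 2) * 1) * ?D"
      by (simp only: mult_1)
    have "d * ?c + (- 1 / 6 * a - (\<omega> - a / 2) * 1) * d = 0" for d
      by (simp add: field_simps)
    then show ?thesis
      unfolding 1 2 3 .
  qed
  have mean: "zero_mean (\<lambda>x. a * x $ 3 + ?Z t x)" for t
    using zero_mean_wave[OF Z[of t] eigenZ[of _ t], of a 1] by (simp only: mult_1)
  have G: "is_\<G> (\<lambda>x. a * x $ 3 + ?Z t x) (?\<psi> t)" for t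
    using is_\<G>_wave[OF Z[of t] eigenZ[of _ t], of a 1] by (simp only: mult_1)
  have \<psi>: "smooth_on (?\<psi> t) S2" for t
    by (rule smooth_on_wave[OF Z[of t] eigenZ[of _ t], of "a / 2" "1 / 6"])
  show ?thesis
    unfolding smooth_solution_def
  proof (intro conjI exI[of _ ?\<psi>] allI ballI impI)
    show "smooth_on (\<lambda>(x, t). a * x $ 3 + ?Z t x) (S2 \<times> {0..})"
      by (rule smooth_on_rot3_time[OF smooth, of a \<beta> ?c])
    fix t
    show "zero_mean (\<lambda>x. a * x $ 3 + ?Z t x)" by (rule mean[of t])
    show "smooth_on (?\<psi> t) S2" by (rule \<psi>[of t])
    show "is_\<G> (\<lambda>x. a * x $ 3 + ?Z t x) (?\<psi> t)" by (rule G[of t])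
    fix x :: "real ^ 3"
    assume x: "x \<in> S2"
    show "deriv (\<lambda>s. a * x $ 3 + ?Z s x) t
      + J x (grad (\<lambda>y. \<omega> * y $ 3 - ?\<psi> t y) x) \<bullet> grad (\<lambda>x. a * x $ 3 + ?Z t x) x = 0"
      by (rule eqn[OF x, of t])
  qed
qed

text \<open>The phase runs round the whole circle in either direction, so after enough full turns it
  meets \<open>\<beta>'\<close> at a positive time.\<close>

lemma exists_positive_time:
  assumes "c \<noteq> (0 :: real)"
  obtains t and k :: int where "t > 0" "\<beta> + c * t = \<beta>' + 2 * pi * of_int k"
proof -
  obtain n :: nat where n: "\<bar>\<beta>' - \<beta>\<bar> / (2 * pi) < real n"
    using reals_Archimedean2 by blast
  have n': "\<bar>\<beta>' - \<beta>\<bar> < 2 * pi * real n"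
    using n by (simp add: field_simps)
  \<comment> \<open>Turns are counted in the direction of motion. Their total angle strictly exceeds
    the gap, which makes the time positive even if the two phases agree.\<close>
  define k where "k = (if c > 0 then int n else - int n)"
  show ?thesis
  proof
    show "(\<beta>' - \<beta> + 2 * pi * of_int k) / c > 0"
      using assms n' unfolding k_def by (auto simp: zero_less_divide_iff)
    show "\<beta> + c * ((\<beta>' - \<beta> + 2 * pi * of_int k) / c) = \<beta>' + 2 * pi * of_int k"
      using assms by simp
  qed
qed

section \<open>Separation of points in an orbit and distance from compact sets\<close>

lemma poles_rot3:
  assumes "x \<in> S2" "\<not> \<bar>x $ 3\<bar> < 1"
  shows "rot3 \<beta> x = x"
proof -
  have s: "(x $ 1)\<^sup>2 + (x $ 2)\<^sup>2 + (x $ 3)\<^sup>2 = 1"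
    using assms(1) by (simp add: norm_vec_def L2_set_def sum_3)
  have "1 \<le> (x $ 3)\<^sup>2"
    using assms(2) by (simp add: abs_square_less_1[symmetric] not_less)
  then have "(x $ 1)\<^sup>2 + (x $ 2)\<^sup>2 = 0"
    using s zero_le_power2[of "x $ 1"] zero_le_power2[of "x $ 2"] by linarith
  then have "x $ 1 = 0" "x $ 2 = 0"
    by (simp_all add: sum_power2_eq_zero_iff)
  then show ?thesis by (simp add: rot3_def vec_eq_iff forall_3)
qed

lemma Hplus_orbit_continuous:
  assumes "smooth_on F S2" "f \<in> Hplus_orbit F"
  shows "continuous_on S2 f"
proof -
  obtain \<beta> where f: "f = restrict (F \<circ> rot3 \<beta>) S2"
    using assms(2) by (auto simp: Hplus_orbit_def Hplus_def)
  show ?thesis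
    by (rule continuous_on_eq[OF smooth_on_sphere_continuous[OF smooth_on_rot3[OF assms(1), of \<beta>]]])
      (simp add: f)
qed

text \<open>Off the poles equality comes from continuity, at the poles from their being fixed by the
  rotations, and off the sphere from \<open>restrict\<close>. Hence proper inclusion in the orbit
  survives the passage to classes modulo null sets.\<close>

lemma Hplus_orbit_eqI:
  assumes F: "smooth_on F S2" and fg: "f \<in> Hplus_orbit F" "g \<in> Hplus_orbit F"
    and p: "0 < p" "Lp_norm p (\<lambda>x. f x - g x) = 0"
  shows "f = g"
proof
  fix x
  obtain \<beta> \<beta>' where f: "f = restrict (F \<circ> rot3 \<beta>) S2" and g: "g = restrict (F \<circ> rot3 \<beta>') S2"
    using fg by (auto simp: Hplus_orbit_def Hplus_def)
  have cont: "continuous_on S2 (\<lambda>x. f x - g x)"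
    using fg by (intro continuous_intros Hplus_orbit_continuous[OF F])
  consider "x \<notin> S2" | "x \<in> S2" "\<bar>x $ 3\<bar> < 1" | "x \<in> S2" "\<not> \<bar>x $ 3\<bar> < 1" by blast
  then show "f x = g x"
  proof cases
    case 1
    then show ?thesis unfolding f g by (simp only: restrict_apply if_False)
  next
    case 2
    then show ?thesis using Lp_norm_eq_0_imp[OF cont p] by simp
  next
    case 3
    then show ?thesis unfolding f g by (simp only: restrict_apply if_True o_apply poles_rot3[OF 3])
  qed
qed

text \<open>Cover \<open>X\<close> by balls of radius one fifth of the distance from the centre to
  \<open>g\<close>. The least radius in a finite subcover works: a point of \<open>X\<close> closer
  to \<open>g\<close> would, by the inequality with factor 4, bring some centre within four fifths
  of its own distance to \<open>g\<close>.\<close>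

lemma compactin_Lp_closed:
  assumes X: "compactin (Lp_topology p) X" "X \<noteq> {}" and p: "1 \<le> p"
    and cont: "\<And>f. f \<in> X \<Longrightarrow> continuous_on S2 f" "continuous_on S2 g"
    and pos: "\<And>f. f \<in> X \<Longrightarrow> 0 < Lp_norm p (\<lambda>x. f x - g x)"
  obtains e where "e > 0" "\<And>f. f \<in> X \<Longrightarrow> e \<le> Lp_norm p (\<lambda>x. f x - g x)"
proof -
  let ?r = "\<lambda>f. Lp_norm p (\<lambda>x. f x - g x) / 5"
  define B where "B = (\<lambda>f. {k \<in> Lp p. Lp_norm p (\<lambda>x. f x - k x) < ?r f})"
  have L: "f \<in> Lp p" if "f \<in> X" for f
    using continuous_in_Lp[OF cont(1)[OF that]] p by simp
  have "openin (Lp_topology p) U" if "U \<in> B ` X" for U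
    unfolding Lp_topology_def
    by (rule topology_generated_by_Basis) (use that L pos in \<open>auto simp: B_def intro!: exI[of _ "?r _"]\<close>)
  moreover have "X \<subseteq> \<Union> (B ` X)"
    using L pos by (auto simp: B_def Lp_norm_zero)
  ultimately obtain \<F> where "finite \<F>" "\<F> \<subseteq> B ` X" "X \<subseteq> \<Union> \<F>"
    using X(1) unfolding compactin_def by metis
  then obtain C where C: "C \<subseteq> X" "finite C" "X \<subseteq> \<Union> (B ` C)"
    by (metis finite_subset_image)
  define e where "e = Min (?r ` C)"
  have e_le: "e \<le> ?r f" if "f \<in> C" for f
    using C(2) that unfolding e_def by (intro Min_le) auto
  have "C \<noteq> {}" using C(3) X(2) by auto
  then have "e \<in> ?r ` C"
    using C(2) unfolding e_def by (intro Min_in) auto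
  then have "e > 0" using C(1) pos by auto
  moreover have "e \<le> Lp_norm p (\<lambda>x. k x - g x)" if k: "k \<in> X" for k
  proof (rule ccontr)
    assume lt: "\<not> e \<le> Lp_norm p (\<lambda>x. k x - g x)"
    obtain f where f: "f \<in> C" "Lp_norm p (\<lambda>x. f x - k x) < ?r f"
      using C(3) k by (auto simp: B_def)
    have "Lp_norm p (\<lambda>x. f x - g x) \<le> 4 * ?r f"
      using f lt e_le[OF f(1)] C(1) k
      by (intro Lp_norm_quasi_triangle[OF cont(1) cont(1) cont(2) p, of f k]) auto
    then show False using pos[of f] f(1) C(1) by auto
  qed
  ultimately show ?thesis using that by blast
qed

text \<open>The perturbed wave at a suitable time is within \<epsilon> of some element of
  \<open>X\<close> and also of \<open>g\<close>; taking it as the middle function in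
  \<open>Lp_norm_quasi_triangle\<close> gives the factor 4.\<close>

lemma stable_subset_dense_in_orbit:
  assumes p: "1 \<le> p" and Y: "Y \<in> E2"
    and X: "X \<noteq> {}" "X \<subseteq> Hplus_orbit (\<lambda>x. \<alpha> * x $ 3 + Y x)"
    and stable: "\<forall>\<epsilon>>0. \<exists>\<delta>>0. \<forall>\<zeta>. smooth_solution \<omega> \<zeta> \<longrightarrow>
         (INF f\<in>X. Lp_norm p (\<lambda>x. f x - \<zeta> 0 x)) < \<delta> \<longrightarrow>
         (\<forall>t>0. (INF f\<in>X. Lp_norm p (\<lambda>x. f x - \<zeta> t x)) < \<epsilon>)"
    and g: "g \<in> Hplus_orbit (\<lambda>x. \<alpha> * x $ 3 + Y x)" and \<epsilon>: "\<epsilon> > 0"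
  shows "\<exists>f\<in>X. Lp_norm p (\<lambda>x. f x - g x) \<le> 4 * \<epsilon>"
proof -
  let ?F = "\<lambda>x. \<alpha> * x $ 3 + Y x"
  obtain f\<^sub>0 where f\<^sub>0: "f\<^sub>0 \<in> X" using X(1) by blast
  obtain \<beta> \<beta>' where f\<^sub>0_eq: "f\<^sub>0 = restrict (?F \<circ> rot3 \<beta>) S2" and g_eq: "g = restrict (?F \<circ> rot3 \<beta>') S2"
    using f\<^sub>0 X(2) g by (auto simp: Hplus_orbit_def Hplus_def)
  have Ys: "smooth_on Y S2" using Y by (simp add: E2_def)
  have F: "smooth_on ?F S2"
    using smooth_on_sphere_lincomb[OF smooth_on_height Ys, of \<alpha> 1] by simp
  obtain \<delta> where \<delta>: "\<delta> > 0" "\<And>\<zeta> t. smooth_solution \<omega> \<zeta> \<Longrightarrow>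
         (INF f\<in>X. Lp_norm p (\<lambda>x. f x - \<zeta> 0 x)) < \<delta> \<Longrightarrow> t > 0 \<Longrightarrow>
         (INF f\<in>X. Lp_norm p (\<lambda>x. f x - \<zeta> t x)) < \<epsilon>"
    using stable \<epsilon> by blast
  let ?M = "Lp_norm p (\<lambda>x. x $ 3)"
  have M: "0 \<le> ?M" by (rule Lp_norm_nonneg)
  \<comment> \<open>Any positive \<eta> below \<open>m\<close> keeps \<open>\<eta> * ?M\<close>
    under both \<delta> and \<epsilon>; the summand 1 keeps the denominator positive.\<close>
  define m where "m = min \<delta> \<epsilon> / (?M + 1)"
  have m: "m > 0" using M \<delta>(1) \<epsilon> by (simp add: m_def)
  \<comment> \<open>The speed vanishes for one value of \<eta> only, so if \<open>m / 2\<close> is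
    that value then \<open>m / 4\<close> is not.\<close>
  obtain \<eta> where \<eta>: "0 < \<eta>" "\<eta> < m" "\<omega> - (\<alpha> + \<eta>) / 3 \<noteq> 0"
  proof (cases "\<omega> - (\<alpha> + m / 2) / 3 = 0")
    case True
    then show ?thesis using m that[of "m / 4"] by simp
  next
    case False
    then show ?thesis using m that[of "m / 2"] by simp
  qed
  have "\<eta> * ?M \<le> m * ?M" using \<eta> M by (intro mult_right_mono) auto
  also have "\<dots> < m * (?M + 1)" using m by simp
  also have "\<dots> = min \<delta> \<epsilon>" using M by (simp add: m_def)
  finally have \<eta>M: "\<eta> * ?M < \<delta>" "\<eta> * ?M < \<epsilon>" by auto
  let ?c = "\<omega> - (\<alpha> + \<eta>) / 3"
  let ?\<zeta> = "\<lambda>t x. (\<alpha> + \<eta>) * x $ 3 + Y (rot3 (\<beta> + ?c * t) x)"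
  obtain t k where t: "t > 0" "\<beta> + ?c * t = \<beta>' + 2 * pi * of_int k"
    using exists_positive_time[OF \<eta>(3)] by blast
  have sol: "smooth_solution \<omega> ?\<zeta>" by (rule rossby_haurwitz_solution[OF Y])
  \<comment> \<open>Wave and orbit element of equal phase \<open>b\<close> share the
    \<open>Y\<close> part and differ by \<eta> times the height, so their distance does not depend
    on \<open>b\<close>.\<close>
  have dist: "Lp_norm p (\<lambda>x. restrict (?F \<circ> rot3 b) S2 x - ((\<alpha> + \<eta>) * x $ 3 + Y (rot3 b x))) = \<eta> * ?M" for b
  proof -
    have "Lp_norm p (\<lambda>x. restrict (?F \<circ> rot3 b) S2 x - ((\<alpha> + \<eta>) * x $ 3 + Y (rot3 b x))) =
        Lp_norm p (\<lambda>x. - \<eta> * x $ 3)"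
      by (rule Lp_norm_cong) (simp add: algebra_simps)
    then show ?thesis using Lp_norm_cmult[of p "- \<eta>" "\<lambda>x. x $ 3"] p \<eta>(1) by simp
  qed
  have bdd: "bdd_below ((\<lambda>f. Lp_norm p (\<lambda>x. f x - u x)) ` X)" for u
    by (rule bdd_belowI2[of _ 0]) (rule Lp_norm_nonneg)
  have "(INF f\<in>X. Lp_norm p (\<lambda>x. f x - ?\<zeta> 0 x)) \<le> Lp_norm p (\<lambda>x. f\<^sub>0 x - ?\<zeta> 0 x)"
    by (rule cINF_lower[OF bdd f\<^sub>0])
  also have "\<dots> = \<eta> * ?M"
    using dist[of \<beta>] by (simp add: f\<^sub>0_eq)
  finally have "(INF f\<in>X. Lp_norm p (\<lambda>x. f x - ?\<zeta> t x)) < \<epsilon>"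
    using \<delta>(2)[OF sol _ t(1)] \<eta>M by simp
  then have "\<exists>f\<in>X. Lp_norm p (\<lambda>x. f x - ?\<zeta> t x) < \<epsilon>"
    by (rule cINF_less_iff[OF X(1) bdd, THEN iffD1])
  then obtain f where f: "f \<in> X" "Lp_norm p (\<lambda>x. f x - ?\<zeta> t x) < \<epsilon>"
    by (elim bexE)
  \<comment> \<open>At time \<open>t\<close> the phase is \<open>\<beta>'\<close> up to full turns,
    so the wave has become the perturbation of \<open>g\<close> itself.\<close>
  have "Lp_norm p (\<lambda>x. ?\<zeta> t x - g x) = \<eta> * ?M"
    unfolding t(2) rot3_periodic using dist[of \<beta>'] unfolding g_eq
    by (subst Lp_norm_minus_commute)
  moreover have "continuous_on S2 (?\<zeta> t)"
    using smooth_on_sphere_lincomb[OF smooth_on_height smooth_on_rot3[OF Ys], of "\<alpha> + \<eta>" 1 "\<beta> + ?c * t"]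
    by (intro smooth_on_sphere_continuous) simp
  ultimately have "Lp_norm p (\<lambda>x. f x - g x) \<le> 4 * \<epsilon>"
    using f(2) \<eta>M(2)
    by (intro Lp_norm_quasi_triangle[OF Hplus_orbit_continuous[OF F subsetD[OF X(2) f(1)]] _
          Hplus_orbit_continuous[OF F g] p, of "?\<zeta> t"]) simp_all
  with f(1) show ?thesis by blast
qed

theorem theorem8p1:
  fixes p \<omega> \<alpha> :: real and Y :: "real ^ 3 \<Rightarrow> real"
  assumes "1 < p" and "\<alpha> \<noteq> 0"
    and "Y \<in> E2" and "\<exists>x\<in>S2. Y x \<noteq> 0"
  shows "\<not> (\<exists>X. compactin (Lp_topology p) X \<and> X \<noteq> {} \<and>
      X \<subset> Hplus_orbit (\<lambda>x. \<alpha> * x $ 3 + Y x) \<and>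
      (\<forall>\<epsilon>>0. \<exists>\<delta>>0. \<forall>\<zeta>. smooth_solution \<omega> \<zeta> \<longrightarrow>
         (INF f\<in>X. Lp_norm p (\<lambda>x. f x - \<zeta> 0 x)) < \<delta> \<longrightarrow>
         (\<forall>t>0. (INF f\<in>X. Lp_norm p (\<lambda>x. f x - \<zeta> t x)) < \<epsilon>)))"
proof
  let ?F = "\<lambda>x. \<alpha> * x $ 3 + Y x"
  assume "\<exists>X. compactin (Lp_topology p) X \<and> X \<noteq> {} \<and> X \<subset> Hplus_orbit ?F \<and>
      (\<forall>\<epsilon>>0. \<exists>\<delta>>0. \<forall>\<zeta>. smooth_solution \<omega> \<zeta> \<longrightarrow>
         (INF f\<in>X. Lp_norm p (\<lambda>x. f x - \<zeta> 0 x)) < \<delta> \<longrightarrow>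
         (\<forall>t>0. (INF f\<in>X. Lp_norm p (\<lambda>x. f x - \<zeta> t x)) < \<epsilon>))"
  then obtain X where compact: "compactin (Lp_topology p) X"
    and X: "X \<noteq> {}" "X \<subset> Hplus_orbit ?F"
    and stable: "\<forall>\<epsilon>>0. \<exists>\<delta>>0. \<forall>\<zeta>. smooth_solution \<omega> \<zeta> \<longrightarrow>
         (INF f\<in>X. Lp_norm p (\<lambda>x. f x - \<zeta> 0 x)) < \<delta> \<longrightarrow>
         (\<forall>t>0. (INF f\<in>X. Lp_norm p (\<lambda>x. f x - \<zeta> t x)) < \<epsilon>)"
    by (elim exE conjE)
  have "smooth_on Y S2" using assms(3) by (simp add: E2_def)
  then have F: "smooth_on ?F S2"
    using smooth_on_sphere_lincomb[OF smooth_on_height, of Y \<alpha> 1] by simp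
  have p: "1 \<le> p" "0 < p" using assms(1) by auto
  obtain g where g: "g \<in> Hplus_orbit ?F" "g \<notin> X" using X(2) by blast
  have "0 < Lp_norm p (\<lambda>x. f x - g x)" if "f \<in> X" for f
  proof (rule ccontr)
    assume "\<not> ?thesis"
    then have "Lp_norm p (\<lambda>x. f x - g x) = 0"
      using Lp_norm_nonneg[of p "\<lambda>x. f x - g x"] by linarith
    then have "f = g"
      using that X(2) by (intro Hplus_orbit_eqI[OF F _ g(1) p(2)]) auto
    then show False using that g(2) by simp
  qed
  moreover have "continuous_on S2 f" if "f \<in> X" for f
    by (rule Hplus_orbit_continuous[OF F subsetD[OF psubset_imp_subset[OF X(2)] that]])
  ultimately obtain e where e: "e > 0" "\<And>f. f \<in> X \<Longrightarrow> e \<le> Lp_norm p (\<lambda>x. f x - g x)"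
    using compactin_Lp_closed[OF compact X(1) p(1) _ Hplus_orbit_continuous[OF F g(1)]] by blast
  \<comment> \<open>Density at scale \<open>e / 5\<close> returns a distance of at most
    \<open>4 * (e / 5)\<close>, which is below the lower bound \<open>e\<close>.\<close>
  have "0 < e / 5" using e(1) by simp
  from stable_subset_dense_in_orbit[OF p(1) assms(3) X(1) psubset_imp_subset[OF X(2)] stable g(1) this]
  obtain f where "f \<in> X" "Lp_norm p (\<lambda>x. f x - g x) \<le> 4 * (e / 5)"
    by (elim bexE)
  then show False using e(1) e(2)[of f] by simp
qed

end
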